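(* For every $\tau\in\mathbb{H}^2$, $$\frac{\theta'[\frac13,\frac53]}{\theta[\frac13,\frac53]}=\frac13\,\frac{\theta'[1,1]\,\theta^3[\frac13,\frac53]}{\theta[0,1]\,\theta^3[\frac23,\frac13]}+\zeta_3^2\,\frac{\theta'[1,1]\,\theta[0,1]\,\theta[\frac13,\frac23]\,\theta[\frac23,\frac43]}{\theta[0,0]\,\theta[1,0]\,\theta[\frac13,\frac53]\,\theta[\frac23,\frac13]}$$ $$=-\frac{\pi}{3}\,\theta[0,0]\,\theta[1,0]\,\frac{\theta^3[\frac13,\frac53]}{\theta^3[\frac23,\frac13]}-\pi\zeta_3^2\,\theta^2[0,1]\,\frac{\theta[\frac13,\frac23]\,\theta[\frac23,\frac43]}{\theta[\frac13,\frac53]\,\theta[\frac23,\frac13]}.$$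
   Context: $\mathbb{H}^2=\{\tau\in\mathbb{C} : \Im\tau>0\}$ is the upper half plane and $\zeta_k=\exp(2\pi i/k)$. For $\epsilon,\epsilon'\in\mathbb{R}$, $\zeta\in\mathbb{C}$, $\tau\in\mathbb{H}^2$, the theta function with characteristics is $$\theta[\epsilon,\epsilon'](\zeta,\tau)=\sum_{n\in\mathbb{Z}}\exp\left(2\pi i\left[\tfrac12\left(n+\tfrac{\epsilon}{2}\right)^2\tau+\left(n+\tfrac{\epsilon}{2}\right)\left(\zeta+\tfrac{\epsilon'}{2}\right)\right]\right).$$ Write $\theta[\epsilon,\epsilon']=\theta[\epsilon,\epsilon'](0,\tau)$ and $\theta'[\epsilon,\epsilon']=\frac{\partial}{\partial\zeta}\theta[\epsilon,\epsilon'](\zeta,\tau)\big|_{\zeta=0}$; $\theta^k[\epsilon,\epsilon']$ means the $k$-th power of $\theta[\epsilon,\epsilon']$. *)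

theory Defs
  imports "HOL-Analysis.Analysis"
begin

definition zeta_root :: "nat \<Rightarrow> complex" where
  "zeta_root k = exp (2 * of_real pi * \<i> / of_nat k)"

text \<open>The theta function with characteristics; the series is summed unconditionally over
  all integers (it converges absolutely for \<open>Im \<tau> > 0\<close>).\<close>

definition theta :: "real \<Rightarrow> real \<Rightarrow> complex \<Rightarrow> complex \<Rightarrow> complex" where
  "theta \<epsilon> \<epsilon>' \<zeta> \<tau> =
     (\<Sum>\<^sub>\<infinity>n::int. exp (2 * of_real pi * \<i> *
        (1 / 2 * (of_int n + of_real \<epsilon> / 2) ^ 2 * \<tau>
         + (of_int n + of_real \<epsilon> / 2) * (\<zeta> + of_real \<epsilon>' / 2))))"

definition theta_null :: "complex \<Rightarrow> real \<Rightarrow> real \<Rightarrow> complex" where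
  "theta_null \<tau> \<epsilon> \<epsilon>' = theta \<epsilon> \<epsilon>' 0 \<tau>"

definition theta_deriv_null :: "complex \<Rightarrow> real \<Rightarrow> real \<Rightarrow> complex" where
  "theta_deriv_null \<tau> \<epsilon> \<epsilon>' = deriv (\<lambda>\<zeta>. theta \<epsilon> \<epsilon>' \<zeta> \<tau>) 0"

end

theory Submission
  imports Defs "HOL-Complex_Analysis.Complex_Analysis" "HOL-Library.Nat_Bijection" "HOL-Real_Asymp.Real_Asymp"
begin

text \<open>The characteristics in thirds hide a 3-torsion point. Up to exponential factors, \<open>\<theta>[1/3,5/3]\<close>, \<open>\<theta>[2/3,1/3]\<close>,
  \<open>\<theta>[1/3,2/3]\<close> and \<open>\<theta>[2/3,4/3]\<close> are the values of the classical functions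
  \<open>\<theta>[1,1]\<close>, \<open>\<theta>[0,1]\<close>, \<open>\<theta>[1,0]\<close> and \<open>\<theta>[0,0]\<close> at \<open>u = (1 - \<tau>) / 3\<close>. The left-hand side is thus the logarithmic
  derivative of \<open>\<theta>[1,1]\<close> at \<open>u\<close> up to an additive constant, and the two terms on the right come from
  writing it as the logarithmic derivative of \<open>\<theta>[0,1]\<close> plus that of the quotient
  \<open>s = \<theta>[1,1] / \<theta>[0,1]\<close>.

  The logarithmic derivative of \<open>s\<close> is the second term; this is the derivative formula of Jacobi's
  function \<open>sn\<close> (\<open>theta_wronskian\<close>). For the first term let \<open>f\<close> be the logarithmic derivative of
  \<open>\<theta>[0,1]\<close>. The addition formulas of \<open>\<theta>[0,1]\<close> and \<open>\<theta>[1,1]\<close> express \<open>f (2 * u) - 2 * f u\<close> as a multiple of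
  \<open>s u ^ 2 * s (2 * u)\<close>. As \<open>2 * u\<close> and \<open>- u\<close> differ by a period, \<open>f (2 * u)\<close> is a constant minus \<open>f u\<close> and
  \<open>s (2 * u) = s u\<close>, so \<open>3 * f u\<close> is a constant plus a multiple of \<open>s u ^ 3\<close>
  (\<open>th01_log_deriv_torsion\<close>). The second equality of the theorem is Jacobi's derivative formula
  \<open>\<theta>'[1,1] = - \<pi> * \<theta>[0,0] * \<theta>[0,1] * \<theta>[1,0]\<close> (\<open>jacobi_derivative_formula\<close>).

  Two tools support this. The double series of a product of two theta functions can be reindexed by sum and
  difference of the summation variables (\<open>theta_char_mult\<close>), which yields the addition formulas. The Jacobi triple product
  (\<open>jacobi_triple_product\<close>), obtained as the limit of the q-binomial theorem, shows that theta
  functions are holomorphic and that the denominators do not vanish, and it reduces the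
  derivative formula to an identity of Euler.\<close>

section \<open>Infinite q-products\<close>

text \<open>The q-Pochhammer symbol \<open>(x; q)\<^sub>\<infinity>\<close>.\<close>

definition qprod :: "complex \<Rightarrow> complex \<Rightarrow> complex" where
  "qprod q x = (\<Prod>n. 1 - x * q ^ n)"

lemma norm_power2_less_1:
  fixes q :: complex
  assumes "norm q < 1"
  shows "norm (q\<^sup>2) < 1"
  using assms by (simp add: norm_power power_less_one_iff)

lemma convergent_qprod:
  fixes q x :: complex
  assumes "norm q < 1"
  shows "convergent_prod (\<lambda>n. 1 - x * q ^ n)"
proof -
  have "summable (\<lambda>n. norm x * norm q ^ n)"
    by (intro summable_mult summable_geometric) (use assms in auto)
  then have "abs_convergent_prod (\<lambda>n. 1 - x * q ^ n)"
    unfolding abs_convergent_prod_conv_summable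
    by (rule back_subst[of summable]) (simp add: norm_mult norm_power)
  then show ?thesis
    by (rule abs_convergent_prod_imp_convergent_prod)
qed

lemma LIMSEQ_qprod:
  assumes "norm q < 1"
  shows "(\<lambda>N. \<Prod>n<N. 1 - x * q ^ n) \<longlonglongrightarrow> qprod q x"
  using convergent_prod_LIMSEQ[OF convergent_qprod[OF assms, of x]]
  by (subst (asm) LIMSEQ_lessThan_iff_atMost[symmetric, where f = "\<lambda>A. \<Prod>n\<in>A. 1 - x * q ^ n"]) (simp add: qprod_def)

lemma qprod_eqI:
  assumes "norm q < 1" "(\<lambda>N. \<Prod>n<N. 1 - x * q ^ n) \<longlonglongrightarrow> y"
  shows "qprod q x = y"
  using LIMSEQ_unique LIMSEQ_qprod assms by blast

lemma qprod_rec: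
  assumes "norm q < 1"
  shows "qprod q x = (1 - x) * qprod q (x * q)"
proof (rule qprod_eqI[OF assms])
  have "(\<lambda>N. (1 - x) * (\<Prod>n<N. 1 - (x * q) * q ^ n)) \<longlonglongrightarrow> (1 - x) * qprod q (x * q)"
    by (intro tendsto_intros LIMSEQ_qprod assms)
  moreover have "(1 - x) * (\<Prod>n<N. 1 - (x * q) * q ^ n) = (\<Prod>n<Suc N. 1 - x * q ^ n)" for N
    by (subst prod.lessThan_Suc_shift) (simp add: mult_ac)
  ultimately have "(\<lambda>N. \<Prod>n<Suc N. 1 - x * q ^ n) \<longlonglongrightarrow> (1 - x) * qprod q (x * q)"
    by simp
  then show "(\<lambda>N. \<Prod>n<N. 1 - x * q ^ n) \<longlonglongrightarrow> (1 - x) * qprod q (x * q)"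
    by (rule LIMSEQ_imp_Suc)
qed

lemma qprod_nonzero:
  assumes "norm q < 1" "\<And>n. x * q ^ n \<noteq> 1"
  shows "qprod q x \<noteq> 0"
  unfolding qprod_def
proof (rule prodinf_nonzero[OF convergent_qprod[OF assms(1)]])
  show "1 - x * q ^ n \<noteq> 0" for n
    using assms(2)[of n] by (metis eq_iff_diff_eq_0)
qed

text \<open>In the product form of a theta function this factor depends on the nome alone. Knowing that it
  does not vanish leaves the two remaining factors to decide about zeros, and it makes the
  Gaussian binomial coefficients converge.\<close>

lemma qprod_self_nonzero:
  assumes "norm q < 1"
  shows "qprod q q \<noteq> 0"
proof (rule qprod_nonzero[OF assms])
  fix n
  have "norm (q * q ^ n) < 1"
    using power_less_one_iff[of "norm q" "Suc n"] assms by (simp add: norm_mult norm_power)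
  then show "q * q ^ n \<noteq> 1" by auto
qed

lemma qprod_mult_minus:
  assumes "norm q < 1"
  shows "qprod q x * qprod q (- x) = qprod (q\<^sup>2) (x\<^sup>2)"
proof (rule sym, rule qprod_eqI)
  show "norm (q\<^sup>2) < 1"
    using assms by (simp_all add: norm_power2_less_1)
  have "(\<lambda>N. (\<Prod>n<N. 1 - x * q ^ n) * (\<Prod>n<N. 1 - (- x) * q ^ n)) \<longlonglongrightarrow> qprod q x * qprod q (- x)"
    by (intro tendsto_mult LIMSEQ_qprod assms)
  moreover have "(\<Prod>n<N. 1 - x * q ^ n) * (\<Prod>n<N. 1 - (- x) * q ^ n) = (\<Prod>n<N. 1 - x\<^sup>2 * (q\<^sup>2) ^ n)" for N
    by (subst prod.distrib[symmetric], rule prod.cong)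
       (auto simp: algebra_simps power2_eq_square power_mult_distrib)
  ultimately show "(\<lambda>N. \<Prod>n<N. 1 - x\<^sup>2 * (q\<^sup>2) ^ n) \<longlonglongrightarrow> qprod q x * qprod q (- x)"
    by simp
qed

lemma qprod_even_odd:
  assumes "norm q < 1"
  shows "qprod (q\<^sup>2) x * qprod (q\<^sup>2) (x * q) = qprod q x"
proof -
  have q2: "norm (q\<^sup>2) < 1"
    using assms by (simp_all add: norm_power2_less_1)
  have "(\<Prod>n<N. 1 - x * (q\<^sup>2) ^ n) * (\<Prod>n<N. 1 - (x * q) * (q\<^sup>2) ^ n) = (\<Prod>n<2 * N. 1 - x * q ^ n)" for N
    by (induction N) (auto simp: mult_ac power_mult[symmetric] simp flip: power_Suc)
  moreover have "(\<lambda>N. (\<Prod>n<N. 1 - x * (q\<^sup>2) ^ n) * (\<Prod>n<N. 1 - (x * q) * (q\<^sup>2) ^ n))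
      \<longlonglongrightarrow> qprod (q\<^sup>2) x * qprod (q\<^sup>2) (x * q)"
    by (intro tendsto_mult LIMSEQ_qprod q2)
  ultimately have "(\<lambda>N. \<Prod>n<2 * N. 1 - x * q ^ n) \<longlonglongrightarrow> qprod (q\<^sup>2) x * qprod (q\<^sup>2) (x * q)"
    by simp
  moreover have "(\<lambda>N. \<Prod>n<2 * N. 1 - x * q ^ n) \<longlonglongrightarrow> qprod q x"
    using LIMSEQ_subseq_LIMSEQ[OF LIMSEQ_qprod[OF assms, of x], of "\<lambda>N. 2 * N"]
    by (auto simp: strict_mono_def o_def)
  ultimately show ?thesis
    using LIMSEQ_unique by blast
qed

text \<open>Euler's identity \<open>(q; q\<^sup>2)\<^sub>\<infinity> (- q; q\<^sup>2)\<^sub>\<infinity> (- q\<^sup>2; q\<^sup>2)\<^sub>\<infinity> = 1\<close>. Merging the factors at \<open>x\<close> and \<open>- x\<close>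
  turns the base \<open>r = q\<^sup>2\<close> into \<open>r\<^sup>2\<close>, and splitting \<open>(r; r)\<^sub>\<infinity>\<close> into even and odd exponents shows
  that everything cancels. It is what makes the product of the three even theta constants
  collapse to the cube that appears in the derivative of the odd theta function.\<close>

lemma euler_product_identity:
  assumes "norm q < 1"
  shows "qprod (q\<^sup>2) q * qprod (q\<^sup>2) (- q) * qprod (q\<^sup>2) (- (q\<^sup>2)) = 1"
proof -
  let ?r = "q\<^sup>2" let ?s = "?r\<^sup>2"
  have r: "norm ?r < 1" and s: "norm ?s < 1"
    by (intro norm_power2_less_1 assms)+
  have "qprod ?r q * qprod ?r (- q) = qprod ?s ?r"
    by (rule qprod_mult_minus[OF r])
  moreover have "qprod ?r ?r * qprod ?r (- ?r) = qprod ?s ?s"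
    by (rule qprod_mult_minus[OF r])
  moreover have "qprod ?s ?r * qprod ?s ?s = qprod ?r ?r"
    using qprod_even_odd[OF r, of ?r] by (simp add: power2_eq_square)
  ultimately have "qprod ?r q * qprod ?r (- q) * qprod ?r (- ?r) * (qprod ?r ?r * qprod ?s ?s)
      = qprod ?r ?r * qprod ?s ?s"
    by (auto simp: mult_ac)
  then show ?thesis
    using qprod_self_nonzero[OF r] qprod_self_nonzero[OF s] by simp
qed

lemma holomorphic_qprod:
  assumes "norm q < 1"
  shows "qprod q holomorphic_on UNIV"
proof (rule holomorphic_uniform_sequence[where f = "\<lambda>N x. \<Prod>n<N. 1 - x * q ^ n"])
  show "(\<lambda>x. \<Prod>n<N. 1 - x * q ^ n) holomorphic_on UNIV" for N
    by (intro holomorphic_intros)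
  fix x :: complex
  have "uniformly_convergent_on (cball x 1) (\<lambda>N y. \<Sum>n<N. norm (1 - y * q ^ n - 1))"
  proof (rule Weierstrass_m_test')
    show "norm (norm (1 - y * q ^ n - 1)) \<le> (norm x + 1) * norm q ^ n" if "y \<in> cball x 1" for n y
    proof -
      have "norm y \<le> norm x + 1"
        using that norm_triangle_sub[of y x] by (auto simp: dist_norm norm_minus_commute)
      then show ?thesis
        by (simp add: norm_mult norm_power mult_right_mono)
    qed
    show "summable (\<lambda>n. (norm x + 1) * norm q ^ n)"
      by (intro summable_mult summable_geometric) (use assms in auto)
  qed
  then have "uniformly_convergent_on (cball x 1) (\<lambda>N y. \<Prod>n<N. 1 - y * q ^ n)"
    by (intro uniformly_convergent_on_prod') (auto intro!: continuous_intros)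
  then obtain l where l: "uniform_limit (cball x 1) (\<lambda>N y. \<Prod>n<N. 1 - y * q ^ n) l sequentially"
    unfolding uniformly_convergent_on_def by blast
  have "uniform_limit (cball x 1) (\<lambda>N y. \<Prod>n<N. 1 - y * q ^ n) (qprod q) sequentially
      \<longleftrightarrow> uniform_limit (cball x 1) (\<lambda>N y. \<Prod>n<N. 1 - y * q ^ n) l sequentially"
    by (rule uniform_limit_cong') (use tendsto_uniform_limitI[OF l] in \<open>auto intro!: qprod_eqI[OF assms]\<close>)
  then show "\<exists>d>0. cball x d \<subseteq> UNIV \<and> uniform_limit (cball x d) (\<lambda>N x. \<Prod>n<N. 1 - x * q ^ n) (qprod q) sequentially"
    using l by (intro exI[of _ 1]) auto
qed auto

section \<open>The Jacobi triple product\<close>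

text \<open>The Gaussian binomial coefficient, given by the Pascal rule instead of a quotient of
  q-factorials, which would be meaningless for a root of unity \<open>q\<close>.\<close>

fun qbinomial :: "complex \<Rightarrow> nat \<Rightarrow> nat \<Rightarrow> complex" where
  "qbinomial q m 0 = 1"
| "qbinomial q 0 (Suc k) = 0"
| "qbinomial q (Suc m) (Suc k) = q ^ Suc k * qbinomial q m (Suc k) + qbinomial q m k"

lemma qbinomial_eq_0: "m < k \<Longrightarrow> qbinomial q m k = 0"
  by (induction q m k rule: qbinomial.induct) auto

text \<open>Splitting off the factor for \<open>k = 0\<close> replaces \<open>x\<close> by \<open>x * q\<close> in the rest, which is the reason
  for the power \<open>q ^ Suc k\<close> in the Pascal rule.\<close>

lemma qbinomial_theorem:
  "(\<Prod>k<m. 1 + x * q ^ k) = (\<Sum>j\<le>m. qbinomial q m j * q ^ (j * (j - 1) div 2) * x ^ j)"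
proof (induction m arbitrary: x)
  case 0
  then show ?case by simp
next
  case (Suc m)
  have tri: "Suc j * (Suc j - 1) div 2 = j * (j - 1) div 2 + j" for j :: nat
  proof -
    have "even (j * (j - 1))" by (cases j) auto
    moreover have "Suc j * (Suc j - 1) = j * (j - 1) + 2 * j"
      by (cases j) (auto simp: algebra_simps)
    ultimately show ?thesis by auto
  qed
  let ?c = "\<lambda>m j. qbinomial q m j * q ^ (j * (j - 1) div 2)"
  have "(\<Prod>k<Suc m. 1 + x * q ^ k) = (1 + x) * (\<Prod>k<m. 1 + (x * q) * q ^ k)"
    by (subst prod.lessThan_Suc_shift) (simp add: mult_ac)
  also have "\<dots> = (\<Sum>j\<le>m. ?c m j * (x * q) ^ j) + (\<Sum>j\<le>m. x * (?c m j * (x * q) ^ j))"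
    by (simp only: Suc distrib_right mult_1_left sum_distrib_left sum.distrib)
  also have "(\<Sum>j\<le>m. ?c m j * (x * q) ^ j) = (\<Sum>j\<le>Suc m. ?c m j * (x * q) ^ j)"
    by (simp add: qbinomial_eq_0)
  also have "\<dots> = 1 + (\<Sum>j\<le>m. ?c m (Suc j) * (x * q) ^ Suc j)"
    by (subst sum.atMost_Suc_shift) simp
  also have "\<dots> + (\<Sum>j\<le>m. x * (?c m j * (x * q) ^ j))
      = 1 + (\<Sum>j\<le>m. ?c m (Suc j) * (x * q) ^ Suc j + x * (?c m j * (x * q) ^ j))"
    by (simp add: sum.distrib)
  also have "\<dots> = 1 + (\<Sum>j\<le>m. ?c (Suc m) (Suc j) * x ^ Suc j)"
    by (intro arg_cong[where f = "\<lambda>y. 1 + y"] sum.cong refl, subst (1 2) tri)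
       (simp add: power_mult_distrib power_add algebra_simps)
  also have "\<dots> = (\<Sum>j\<le>Suc m. ?c (Suc m) j * x ^ j)"
    by (subst sum.atMost_Suc_shift) simp
  finally show ?case .
qed

lemma qbinomial_closed_form:
  assumes "k \<le> m"
  shows "qbinomial q m k * (\<Prod>i<k. 1 - q * q ^ i) * (\<Prod>i<m - k. 1 - q * q ^ i) = (\<Prod>i<m. 1 - q * q ^ i)"
  using assms
proof (induction q m k rule: qbinomial.induct)
  case (3 q m k)
  let ?G = "\<lambda>m. \<Prod>i<m. 1 - q * q ^ i"
  show ?case
  proof (cases "k = m")
    case True
    have "qbinomial q m m * ?G m = ?G m"
      using 3(2) True by simp
    then show ?thesis
      using True by (simp add: qbinomial_eq_0 mult.assoc[symmetric] del: mult_cancel_right mult_cancel_left mult_cancel_right1 mult_cancel_right2 mult_cancel_left1 mult_cancel_left2)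
  next
    case False
    with 3 have k: "k < m" by simp
    define d where "d = m - Suc k"
    have d: "m - k = Suc d" "m = d + Suc k" using k by (auto simp: d_def)
    have 1: "qbinomial q m (Suc k) * ?G (Suc k) * ?G d = ?G m"
      using 3(1) k by (simp add: d_def)
    have 2: "qbinomial q m k * ?G k * ?G (Suc d) = ?G m"
      using 3(2) k by (simp add: d)
    have "qbinomial q (Suc m) (Suc k) * ?G (Suc k) * ?G (Suc m - Suc k)
        = q ^ Suc k * (1 - q ^ Suc d) * (qbinomial q m (Suc k) * ?G (Suc k) * ?G d)
          + (1 - q ^ Suc k) * (qbinomial q m k * ?G k * ?G (Suc d))"
      by (simp add: d(1) algebra_simps)
    also have "\<dots> = (q ^ Suc k * (1 - q ^ Suc d) + (1 - q ^ Suc k)) * ?G m"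
      by (simp only: 1 2 ring_distribs)
    also have "\<dots> = ?G (Suc m)"
      by (simp add: d(2) power_add algebra_simps)
    finally show ?thesis .
  qed
qed auto

text \<open>The q-binomial theorem for base \<open>q\<^sup>2\<close> with \<open>2 * N\<close> factors, evaluated at
  \<open>w * q powi (1 - 2 * N)\<close>: the exponents of \<open>q\<close> in the factors are then the odd numbers from
  \<open>1 - 2 * N\<close> to \<open>2 * N - 1\<close>, and those with negative exponent become the factors in \<open>1 / w\<close> after a
  monomial has been taken out.\<close>

lemma finite_jacobi_triple_product:
  assumes "q \<noteq> 0" "w \<noteq> 0"
  shows "(\<Prod>k<N. (1 + w * q ^ (2 * k + 1)) * (1 + q ^ (2 * k + 1) / w)) =
    (\<Sum>j\<le>2 * N. qbinomial (q\<^sup>2) (2 * N) j * q powi (int j - int N)\<^sup>2 * w powi (int j - int N))"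
proof -
  define x where "x = w * q powi (1 - 2 * int N)"
  define f where "f = (\<lambda>k. 1 + x * (q\<^sup>2) ^ k)"
  have sq: "(q\<^sup>2) ^ k = q powi (2 * int k)" for k
    by (simp add: power_int_mult)
  have pq: "q ^ k = q powi int k" for k
    by simp
  have add: "q powi a * q powi b = q powi (a + b)" for a b
    using assms by (simp add: power_int_add)
  have upper: "f (N + k) = 1 + w * q ^ (2 * k + 1)" for k
  proof -
    have e: "1 - 2 * int N + 2 * int (N + k) = int (2 * k + 1)"
      by simp
    show ?thesis
      unfolding f_def x_def sq mult.assoc add e power_int_of_nat ..
  qed
  have lower: "f (N - Suc k) = w * q powi (- (2 * int k + 1)) * (1 + q ^ (2 * k + 1) / w)" if "k < N" for k
  proof -
    have e: "int (N - Suc k) = int N - 1 - int k"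
      using that by simp
    have "f (N - Suc k) = 1 + w * q powi (- (2 * int k + 1))"
      unfolding f_def x_def sq e by (simp add: mult.assoc add algebra_simps)
    moreover have "q powi (- (2 * int k + 1)) * q ^ (2 * k + 1) = 1"
      unfolding pq add by simp
    ultimately show ?thesis
      using assms by (simp add: field_simps)
  qed
  have split: "(\<Prod>k<N + M. f k) = (\<Prod>k<N. f k) * (\<Prod>k<M. f (N + k))" for M
    by (induction M) (simp_all add: mult.assoc)
  have pre: "(\<Prod>k<N. w * q powi (- (2 * int k + 1))) = w ^ N * q powi (- (int N)\<^sup>2)"
  proof (induction N)
    case (Suc N)
    have "(\<Prod>k<Suc N. w * q powi (- (2 * int k + 1)))
        = w ^ Suc N * (q powi (- (int N)\<^sup>2) * q powi (- (2 * int N + 1)))"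
      using Suc by simp
    also have "q powi (- (int N)\<^sup>2) * q powi (- (2 * int N + 1)) = q powi (- (int (Suc N))\<^sup>2)"
      unfolding add by (rule arg_cong[where f = "\<lambda>a. q powi a"]) (simp add: power2_eq_square algebra_simps)
    finally show ?case .
  qed simp
  have "(\<Prod>k<2 * N. f k) = (\<Prod>k<N. f k) * (\<Prod>k<N. f (N + k))"
    using split[of N] by (simp add: mult_2)
  also have "(\<Prod>k<N. f k) = (\<Prod>k<N. f (N - Suc k))"
    by (rule prod.nat_diff_reindex[symmetric])
  also have "\<dots> = (\<Prod>k<N. w * q powi (- (2 * int k + 1)) * (1 + q ^ (2 * k + 1) / w))"
    by (rule prod.cong) (auto simp: lower)
  also have "\<dots> = w ^ N * q powi (- (int N)\<^sup>2) * (\<Prod>k<N. 1 + q ^ (2 * k + 1) / w)"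
    unfolding pre[symmetric] prod.distrib ..
  finally have prod: "(\<Prod>k<2 * N. f k) = w ^ N * q powi (- (int N)\<^sup>2) *
      (\<Prod>k<N. (1 + w * q ^ (2 * k + 1)) * (1 + q ^ (2 * k + 1) / w))"
    by (simp add: upper prod.distrib mult_ac)
  have summand: "(q\<^sup>2) ^ (j * (j - 1) div 2) * x ^ j =
      w ^ N * q powi (- (int N)\<^sup>2) * (q powi (int j - int N)\<^sup>2 * w powi (int j - int N))" for j
  proof -
    have "even (j * (j - 1))" by (cases j) auto
    then have "(q\<^sup>2) ^ (j * (j - 1) div 2) = q ^ (j * (j - 1))"
      by (simp flip: power_mult)
    also have "\<dots> = q powi ((int j)\<^sup>2 - int j)"
      unfolding pq by (cases j) (auto simp: power2_eq_square algebra_simps)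
    finally have 1: "(q\<^sup>2) ^ (j * (j - 1) div 2) = q powi ((int j)\<^sup>2 - int j)" .
    have 2: "x ^ j = w ^ j * q powi ((1 - 2 * int N) * int j)"
      by (simp add: x_def power_mult_distrib power_int_mult)
    have 3: "w ^ N * w powi (int j - int N) = w ^ j"
      using assms by (simp add: power_int_diff)
    have "q powi ((int j)\<^sup>2 - int j) * q powi ((1 - 2 * int N) * int j)
        = q powi (- (int N)\<^sup>2) * q powi (int j - int N)\<^sup>2"
      unfolding add by (rule arg_cong[where f = "\<lambda>a. q powi a"]) (simp add: power2_eq_square algebra_simps)
    then show ?thesis
      unfolding 1 2 3[symmetric] by (simp add: mult_ac)
  qed
  have "(\<Prod>k<2 * N. f k) = (\<Sum>j\<le>2 * N. qbinomial (q\<^sup>2) (2 * N) j * ((q\<^sup>2) ^ (j * (j - 1) div 2) * x ^ j))"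
    unfolding f_def by (subst qbinomial_theorem) (simp add: mult.assoc)
  also have "\<dots> = w ^ N * q powi (- (int N)\<^sup>2) *
      (\<Sum>j\<le>2 * N. qbinomial (q\<^sup>2) (2 * N) j * (q powi (int j - int N)\<^sup>2 * w powi (int j - int N)))"
    unfolding summand by (simp add: sum_distrib_left mult_ac)
  finally show ?thesis
    unfolding prod using assms by (simp add: mult.assoc)
qed

text \<open>The quadratic exponent beats any geometric growth: eventually \<open>r ^ n * s < 1 / 2\<close>.\<close>

lemma summable_power_square:
  fixes r s :: real
  assumes "0 \<le> r" "r < 1" "0 \<le> s"
  shows "summable (\<lambda>n. r ^ n\<^sup>2 * s ^ n)"
proof (rule summable_comparison_test_ev)
  have "(\<lambda>n. r ^ n * s) \<longlonglongrightarrow> 0"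
    using assms by (intro tendsto_mult_left_zero LIMSEQ_power_zero) auto
  then have "eventually (\<lambda>n. r ^ n * s < 1 / 2) sequentially"
    by (rule order_tendstoD) simp
  then show "eventually (\<lambda>n. norm (r ^ n\<^sup>2 * s ^ n) \<le> (1 / 2) ^ n) sequentially"
  proof eventually_elim
    case (elim n)
    have "(r ^ n * s) ^ n \<le> (1 / 2) ^ n"
      using assms elim by (intro power_mono) auto
    then show ?case
      using assms by (simp add: power_mult_distrib power2_eq_square flip: power_mult)
  qed
qed (simp add: summable_geometric)

lemma abs_summable_theta_series:
  fixes q w :: complex
  assumes "norm q < 1"
  shows "(\<lambda>n::int. norm (q powi n\<^sup>2 * w powi n)) summable_on UNIV"
proof -
  let ?t = "\<lambda>n::int. norm (q powi n\<^sup>2 * w powi n)"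
  have *: "(\<lambda>n. norm q ^ n\<^sup>2 * norm v ^ n) summable_on UNIV" for v :: complex
    using assms by (intro summable_nonneg_imp_summable_on summable_power_square) auto
  have "?t summable_on range int"
    using *[of w]
    by (subst summable_on_reindex)
       (auto simp: o_def norm_mult norm_power_int norm_power simp flip: of_nat_power)
  moreover have "?t summable_on range (\<lambda>n. - int n)"
    using *[of "inverse w"]
    by (subst summable_on_reindex)
       (auto simp: o_def norm_mult norm_power_int norm_power norm_inverse power_int_minus inj_def power_inverse simp flip: of_nat_power)
  moreover have "(UNIV :: int set) = range int \<union> range (\<lambda>n. - int n)"
    using int_cases2 by blast
  ultimately show ?thesis
    using summable_on_union[of ?t "range int" "range (\<lambda>n. - int n)"] by presburger
qed

text \<open>Tannery's theorem for sums over the integers, transported along a bijection of the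
  naturals with the integers.\<close>

lemma tannery_infsum_int:
  fixes a :: "nat \<Rightarrow> int \<Rightarrow> complex"
  assumes "\<And>n. (\<lambda>N. a N n) \<longlonglongrightarrow> b n" "\<And>N n. norm (a N n) \<le> M n" "M summable_on UNIV"
  shows "(\<lambda>N. \<Sum>\<^sub>\<infinity>n. a N n) \<longlonglongrightarrow> (\<Sum>\<^sub>\<infinity>n. b n)" "(\<lambda>n. norm (b n)) summable_on UNIV"
proof -
  have "summable (\<lambda>k. M (int_decode k))"
    using assms(3) summable_on_reindex_bij_betw[OF bij_int_decode, of M]
    by (intro summable_on_imp_summable) blast
  moreover have "eventually (\<lambda>(k, N). norm (a N (int_decode k)) \<le> M (int_decode k)) (at_top \<times>\<^sub>F sequentially)"
    by (rule always_eventually) (use assms(2) in auto)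
  ultimately have *: "(\<lambda>N. \<Sum>k. a N (int_decode k)) \<longlonglongrightarrow> (\<Sum>k. b (int_decode k))"
    using tannerys_theorem[of "\<lambda>k N. a N (int_decode k)" "\<lambda>k. b (int_decode k)" sequentially "\<lambda>k. M (int_decode k)"]
      assms(1) trivial_limit_sequentially by blast
  have a: "(\<lambda>n. norm (a N n)) summable_on UNIV" for N
    by (intro summable_on_comparison_test[OF assms(3)] norm_ge_zero assms(2))
  have "norm (b n) \<le> M n" for n
    by (rule Lim_bounded[OF tendsto_norm[OF assms(1)[of n]], of 0]) (simp add: assms(2))
  then show b: "(\<lambda>n. norm (b n)) summable_on UNIV"
    by (intro summable_on_comparison_test[OF assms(3)] norm_ge_zero)
  have suminf: "(\<Sum>k. c (int_decode k)) = (\<Sum>\<^sub>\<infinity>n. c n)" if "(\<lambda>n. norm (c n)) summable_on UNIV" for c :: "int \<Rightarrow> complex"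
  proof -
    have "(c has_sum (\<Sum>\<^sub>\<infinity>n. c n)) UNIV"
      using abs_summable_summable[OF that] by (rule has_sum_infsum)
    then have "((\<lambda>k. c (int_decode k)) has_sum (\<Sum>\<^sub>\<infinity>n. c n)) UNIV"
      using has_sum_reindex_bij_betw[OF bij_int_decode] by blast
    then show ?thesis
      by (rule sums_unique[OF has_sum_imp_sums, symmetric])
  qed
  show "(\<lambda>N. \<Sum>\<^sub>\<infinity>n. a N n) \<longlonglongrightarrow> (\<Sum>\<^sub>\<infinity>n. b n)"
    using * by (simp add: suminf[OF a] suminf[OF b])
qed

text \<open>The limit of the finite identity. The coefficient of \<open>q powi n\<^sup>2 * w powi n\<close> there is a quotient of
  finite products that all converge to \<open>(q\<^sup>2; q\<^sup>2)\<^sub>\<infinity>\<close>; it is bounded in \<open>N\<close> and \<open>n\<close> and tends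
  to \<open>1 / (q\<^sup>2; q\<^sup>2)\<^sub>\<infinity>\<close>, so the sum and the limit may be exchanged.\<close>

lemma jacobi_triple_product:
  assumes "norm q < 1" "q \<noteq> 0" "w \<noteq> 0"
  shows "(\<Sum>\<^sub>\<infinity>n::int. q powi n\<^sup>2 * w powi n)
       = qprod (q\<^sup>2) (q\<^sup>2) * qprod (q\<^sup>2) (- (q * w)) * qprod (q\<^sup>2) (- (q / w))"
proof -
  let ?r = "q\<^sup>2"
  let ?G = "\<lambda>m. \<Prod>i<m. 1 - ?r * ?r ^ i"
  let ?t = "\<lambda>n::int. q powi n\<^sup>2 * w powi n"
  have r: "norm ?r < 1"
    using assms by (simp_all add: norm_power2_less_1)
  have G_nz: "?G m \<noteq> 0" for m
  proof -
    have "norm (?r * ?r ^ i) < 1" for i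
      using power_less_one_iff[of "norm ?r" "Suc i"] r by (simp add: norm_mult norm_power)
    then have "?r * ?r ^ i \<noteq> 1" for i
      by (metis less_irrefl norm_one)
    then show ?thesis by simp
  qed
  have G_lim: "?G \<longlonglongrightarrow> qprod ?r ?r"
    by (rule LIMSEQ_qprod[OF r])
  have inv_lim: "(\<lambda>m. inverse (?G m)) \<longlonglongrightarrow> inverse (qprod ?r ?r)"
    by (intro tendsto_inverse G_lim qprod_self_nonzero r)
  obtain B where B: "\<And>m. norm (?G m) \<le> B"
    using convergent_imp_Bseq[OF convergentI[OF G_lim]] unfolding Bseq_def by metis
  obtain C where C: "\<And>m. norm (inverse (?G m)) \<le> C"
    using convergent_imp_Bseq[OF convergentI[OF inv_lim]] unfolding Bseq_def by metis
  \<comment> \<open>The coefficients of the finite identity, set to zero outside its range of summation.\<close>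
  define c where "c = (\<lambda>N n. if \<bar>n\<bar> \<le> int N then qbinomial ?r (2 * N) (nat (int N + n)) else 0)"
  have c_eq: "c N n = ?G (2 * N) * inverse (?G (nat (int N + n))) * inverse (?G (nat (int N - n)))"
    if "\<bar>n\<bar> \<le> int N" for N n
  proof -
    have le: "nat (int N + n) \<le> 2 * N" "2 * N - nat (int N + n) = nat (int N - n)"
      using that by linarith+
    have solve: "x = z * inverse u * inverse v" if "x * u * v = z" "u \<noteq> 0" "v \<noteq> 0" for x u v z :: complex
      using that by (simp add: field_simps)
    have "c N n = qbinomial ?r (2 * N) (nat (int N + n))"
      using that by (simp add: c_def)
    also have "\<dots> = ?G (2 * N) * inverse (?G (nat (int N + n))) * inverse (?G (nat (int N - n)))"
      using qbinomial_closed_form[OF le(1), of ?r] unfolding le(2)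
      by (rule solve) (rule G_nz)+
    finally show ?thesis .
  qed
  have c_lim: "(\<lambda>N. c N n) \<longlonglongrightarrow> inverse (qprod ?r ?r)" for n
  proof -
    have "filterlim (\<lambda>N. nat (int N + n)) sequentially sequentially"
         "filterlim (\<lambda>N. nat (int N - n)) sequentially sequentially"
      by real_asymp+
    moreover have "filterlim (\<lambda>N. 2 * N) sequentially (sequentially :: nat filter)"
      by (simp add: filterlim_subseq strict_mono_def)
    ultimately have "(\<lambda>N. ?G (2 * N) * inverse (?G (nat (int N + n))) * inverse (?G (nat (int N - n))))
        \<longlonglongrightarrow> qprod ?r ?r * inverse (qprod ?r ?r) * inverse (qprod ?r ?r)"
      by (intro tendsto_mult filterlim_compose[OF G_lim] filterlim_compose[OF inv_lim])
    moreover have "eventually (\<lambda>N. \<bar>n\<bar> \<le> int N) sequentially"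
      using eventually_ge_at_top[of "nat \<bar>n\<bar>"] by eventually_elim auto
    then have "eventually (\<lambda>N. ?G (2 * N) * inverse (?G (nat (int N + n))) * inverse (?G (nat (int N - n))) = c N n) sequentially"
      by eventually_elim (simp only: c_eq)
    ultimately show ?thesis
      using qprod_self_nonzero[OF r] by (auto dest: Lim_transform_eventually)
  qed
  have c_bound: "norm (c N n) \<le> B * C * C" for N n
  proof (cases "\<bar>n\<bar> \<le> int N")
    case True
    have "norm (?G (2 * N)) * norm (inverse (?G (nat (int N + n)))) * norm (inverse (?G (nat (int N - n)))) \<le> B * C * C"
      using B C by (intro mult_mono mult_nonneg_nonneg order_trans[OF norm_ge_zero]) auto
    then show ?thesis by (simp only: c_eq[OF True] norm_mult)
  next
    case False
    have "0 \<le> B" "0 \<le> C"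
      using B C norm_ge_zero order_trans by blast+
    then show ?thesis using False by (simp add: c_def)
  qed
  have finite: "(\<Sum>\<^sub>\<infinity>n. c N n * ?t n) = (\<Prod>k<N. 1 - (- (q * w)) * ?r ^ k) * (\<Prod>k<N. 1 - (- (q / w)) * ?r ^ k)" for N
  proof -
    have "(\<Sum>\<^sub>\<infinity>n. c N n * ?t n) = (\<Sum>\<^sub>\<infinity>n\<in>{- int N..int N}. c N n * ?t n)"
      by (rule infsum_cong_neutral) (auto simp: c_def)
    also have "\<dots> = (\<Sum>n = - int N..int N. qbinomial ?r (2 * N) (nat (int N + n)) * ?t n)"
      by (simp, rule sum.cong) (auto simp: c_def)
    also have "\<dots> = (\<Sum>j\<le>2 * N. qbinomial ?r (2 * N) j * ?t (int j - int N))"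
      by (rule sum.reindex_bij_witness[of _ "\<lambda>j. int j - int N" "\<lambda>n. nat (int N + n)"]) auto
    also have "\<dots> = (\<Prod>k<N. (1 + w * q ^ (2 * k + 1)) * (1 + q ^ (2 * k + 1) / w))"
      by (subst finite_jacobi_triple_product) (use assms in \<open>auto simp: mult.assoc\<close>)
    also have "\<dots> = (\<Prod>k<N. 1 - (- (q * w)) * ?r ^ k) * (\<Prod>k<N. 1 - (- (q / w)) * ?r ^ k)"
      unfolding prod.distrib by (simp add: power_mult[symmetric] mult_ac)
    finally show ?thesis .
  qed
  have "(\<lambda>N. \<Sum>\<^sub>\<infinity>n. c N n * ?t n) \<longlonglongrightarrow> (\<Sum>\<^sub>\<infinity>n. inverse (qprod ?r ?r) * ?t n)"
  proof (rule tannery_infsum_int)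
    show "norm (c N n * ?t n) \<le> (B * C * C) * norm (?t n)" for N n
      unfolding norm_mult[of "c N n"] by (intro mult_right_mono c_bound) auto
    show "(\<lambda>n. (B * C * C) * norm (?t n)) summable_on UNIV"
      by (intro summable_on_cmult_right abs_summable_theta_series assms)
  qed (intro tendsto_intros c_lim)
  moreover have "(\<lambda>N. \<Sum>\<^sub>\<infinity>n. c N n * ?t n) \<longlonglongrightarrow> qprod ?r (- (q * w)) * qprod ?r (- (q / w))"
    unfolding finite by (intro tendsto_mult LIMSEQ_qprod r)
  ultimately have "(\<Sum>\<^sub>\<infinity>n. inverse (qprod ?r ?r) * ?t n) = qprod ?r (- (q * w)) * qprod ?r (- (q / w))"
    by (rule LIMSEQ_unique)
  then show ?thesis
    using qprod_self_nonzero[OF r] unfolding infsum_cmult_right' by (simp add: field_simps)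
qed

section \<open>Theta functions with characteristics\<close>

abbreviation "pii \<equiv> complex_of_real pi * \<i>"

text \<open>The theta function with a complex first characteristic, normalised without the factor one half
  and with the second characteristic absorbed into the argument. With this freedom, translations
  by 1 and by complex multiples of the period are simple rules, and a translate by a torsion
  point is again a theta function with characteristics.\<close>

definition theta_char :: "complex \<Rightarrow> complex \<Rightarrow> complex \<Rightarrow> complex" where
  "theta_char \<tau> a z = (\<Sum>\<^sub>\<infinity>n::int. exp (pii * (of_int n + a)\<^sup>2 * \<tau> + 2 * pii * (of_int n + a) * z))"

lemma theta_eq_theta_char:
  "theta \<epsilon> \<epsilon>' \<zeta> \<tau> = theta_char \<tau> (of_real \<epsilon> / 2) (\<zeta> + of_real \<epsilon>' / 2)"
  unfolding theta_def theta_char_def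
  by (intro infsum_cong arg_cong[where f = exp]) (simp add: algebra_simps)

lemma exp_times_of_int: "exp (x * of_int n) = exp (x :: complex) powi n"
proof (cases n rule: int_cases2)
  case (nonneg m)
  then show ?thesis by (simp add: exp_of_nat2_mult)
next
  case (nonpos m)
  then show ?thesis by (simp add: exp_minus exp_of_nat2_mult power_int_minus)
qed

lemma theta_char_term:
  "exp (pii * (of_int n + a)\<^sup>2 * \<tau> + 2 * pii * (of_int n + a) * z) =
   exp (pii * a\<^sup>2 * \<tau> + 2 * pii * a * z) *
   (exp (pii * \<tau>) powi n\<^sup>2 * exp (2 * pii * (z + a * \<tau>)) powi n)"
  unfolding exp_times_of_int[symmetric] exp_add[symmetric]
  by (rule arg_cong[where f = exp]) (simp add: power2_eq_square algebra_simps)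

lemma norm_nome_less_1:
  assumes "Im \<tau> > 0"
  shows "norm (exp (pii * \<tau>)) < 1"
  using assms by simp

lemma abs_summable_theta_char:
  assumes "Im \<tau> > 0"
  shows "(\<lambda>n. norm (exp (pii * (of_int n + a)\<^sup>2 * \<tau> + 2 * pii * (of_int n + a) * z))) summable_on (UNIV :: int set)"
  unfolding theta_char_term norm_mult[of "exp (pii * a\<^sup>2 * \<tau> + 2 * pii * a * z)"]
  by (intro summable_on_cmult_right abs_summable_theta_series norm_nome_less_1 assms)

text \<open>The triple product gives holomorphy, zeros and special values of the theta function at once.\<close>

lemma theta_char_product_formula:
  assumes "Im \<tau> > 0"
  defines "q \<equiv> exp (pii * \<tau>)"
  shows "theta_char \<tau> a z = exp (pii * a\<^sup>2 * \<tau> + 2 * pii * a * z) *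
    (qprod (q\<^sup>2) (q\<^sup>2) * qprod (q\<^sup>2) (- (q * exp (2 * pii * (z + a * \<tau>))))
      * qprod (q\<^sup>2) (- (q / exp (2 * pii * (z + a * \<tau>)))))"
  using jacobi_triple_product[of q "exp (2 * pii * (z + a * \<tau>))"] norm_nome_less_1[OF assms(1)]
  unfolding theta_char_def theta_char_term q_def infsum_cmult_right' by simp

lemma theta_char_characteristic_plus_1: "theta_char \<tau> (a + 1) z = theta_char \<tau> a z"
  unfolding theta_char_def
  by (rule infsum_reindex_bij_witness[of _ "\<lambda>n. n - 1" "\<lambda>n. n + 1"]) (auto simp: algebra_simps)

lemma theta_char_minus: "theta_char \<tau> a (- z) = theta_char \<tau> (- a) z"
  unfolding theta_char_def
  by (rule infsum_reindex_bij_witness[of _ uminus uminus]) (auto simp: power2_eq_square algebra_simps)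

lemma theta_char_plus_period: "theta_char \<tau> a (z + c * \<tau>) = exp (- pii * (c\<^sup>2 * \<tau> + 2 * c * z)) * theta_char \<tau> (a + c) z"
  unfolding theta_char_def infsum_cmult_right'[symmetric] exp_add[symmetric]
  by (intro infsum_cong arg_cong[where f = exp]) (simp add: power2_eq_square algebra_simps)

lemma theta_char_plus_1: "theta_char \<tau> a (z + 1) = exp (2 * pii * a) * theta_char \<tau> a z"
proof -
  have "exp (pii * (of_int n + a)\<^sup>2 * \<tau> + 2 * pii * (of_int n + a) * (z + 1)) =
      exp (2 * pii * a) * exp (pii * (of_int n + a)\<^sup>2 * \<tau> + 2 * pii * (of_int n + a) * z)" for n
  proof -
    have 1: "exp (2 * pii * of_int n) = 1"
      using exp_integer_2pi[of "of_int n"] by (simp add: mult_ac)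
    have "exp (pii * (of_int n + a)\<^sup>2 * \<tau> + 2 * pii * (of_int n + a) * (z + 1)) =
      exp (2 * pii * of_int n) * (exp (2 * pii * a) * exp (pii * (of_int n + a)\<^sup>2 * \<tau> + 2 * pii * (of_int n + a) * z))"
      unfolding exp_add[symmetric] by (intro arg_cong[where f = exp]) (simp add: algebra_simps)
    then show ?thesis unfolding 1 by simp
  qed
  then show ?thesis
    unfolding theta_char_def infsum_cmult_right'[symmetric] by simp
qed

lemma holomorphic_theta_char:
  assumes "Im \<tau> > 0"
  shows "theta_char \<tau> a holomorphic_on UNIV"
proof -
  let ?q = "exp (pii * \<tau>)"
  have "norm (?q\<^sup>2) < 1"
    by (rule norm_power2_less_1[OF norm_nome_less_1[OF assms]])
  then have "qprod (?q\<^sup>2) \<circ> f holomorphic_on UNIV" if "f holomorphic_on UNIV" for f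
    using holomorphic_on_compose_gen[OF that holomorphic_qprod] by blast
  then have *: "(\<lambda>z. qprod (?q\<^sup>2) (f z)) holomorphic_on UNIV" if "f holomorphic_on UNIV" for f
    using that by (simp add: o_def)
  show ?thesis
    unfolding theta_char_product_formula[OF assms]
    by (intro holomorphic_intros *) auto
qed

text \<open>A product of two theta functions is a double sum over \<open>(m, n)\<close>. The substitution
  \<open>(r + s + j, r - s)\<close>, where \<open>j\<close> is the parity of \<open>m + n\<close>, diagonalises the sum of two squares in
  the exponent at the cost of doubling the period, because
  \<open>(R + S)\<^sup>2 + (R - S)\<^sup>2 = 2 * R\<^sup>2 + 2 * S\<^sup>2\<close>. All quadratic relations between theta functions that
  are needed below are bilinear consequences of this one.\<close>

lemma theta_char_mult:
  assumes "Im \<tau> > 0"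
  shows "theta_char \<tau> a (x + y) * theta_char \<tau> b (x - y) =
    theta_char (2 * \<tau>) ((a + b) / 2) (2 * x) * theta_char (2 * \<tau>) ((a - b) / 2) (2 * y) +
    theta_char (2 * \<tau>) ((1 + a + b) / 2) (2 * x) * theta_char (2 * \<tau>) ((1 + a - b) / 2) (2 * y)"
proof -
  define t where "t = (\<lambda>\<tau> a z (n::int). exp (pii * (of_int n + a)\<^sup>2 * \<tau> + 2 * pii * (of_int n + a) * z))"
  have tc: "theta_char \<sigma> c z = infsum (t \<sigma> c z) UNIV" for \<sigma> c z
    by (simp add: theta_char_def t_def)
  have summable: "(\<lambda>n. norm (t \<sigma> c z n)) summable_on UNIV" if "Im \<sigma> > 0" for \<sigma> c z
    unfolding t_def by (rule abs_summable_theta_char[OF that])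
  have prod: "((\<lambda>(m, n). t \<sigma> c z m * t \<sigma> d w n) has_sum theta_char \<sigma> c z * theta_char \<sigma> d w) UNIV"
    if "Im \<sigma> > 0" for \<sigma> c z d w
  proof -
    have "(\<lambda>(m, n). t \<sigma> c z m * t \<sigma> d w n) summable_on UNIV \<times> UNIV"
      by (rule Infinite_Sum.abs_summable_summable, subst Infinite_Sum.abs_summable_on_Sigma_iff)
         (use summable[OF that] in
           \<open>simp add: norm_mult infsum_cmult_right' abs_mult summable_on_cmult_left summable_on_cmult_right\<close>)
    then have "((\<lambda>(m, n). t \<sigma> c z m * t \<sigma> d w n) has_sum
        (\<Sum>\<^sub>\<infinity>m. \<Sum>\<^sub>\<infinity>n. t \<sigma> c z m * t \<sigma> d w n)) (UNIV \<times> UNIV)"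
      by (simp add: infsum_Sigma'_banach)
    then show ?thesis
      by (simp add: tc infsum_cmult_right' infsum_cmult_left')
  qed
  have part: "((\<lambda>(m, n). t \<tau> a (x + y) m * t \<tau> b (x - y) n) has_sum
      theta_char (2 * \<tau>) ((of_int j + a + b) / 2) (2 * x) * theta_char (2 * \<tau>) ((of_int j + a - b) / 2) (2 * y))
      {(m, n). (m + n) mod 2 = j}" if j: "j = 0 \<or> j = 1" for j :: int
  proof -
    let ?g = "\<lambda>(r, s). (r + s + j, r - s)"
    have bij: "bij_betw ?g UNIV {(m, n). (m + n) mod 2 = j}"
    proof (rule bij_betwI[where g = "\<lambda>(m, n). ((m + n) div 2, (m - n) div 2)"])
      have "(r + s + j + (r - s)) mod 2 = j" for r s
        using j by presburger
      then show "?g \<in> UNIV \<rightarrow> {(m, n). (m + n) mod 2 = j}"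
        by auto
      have "(r + s + j + (r - s)) div 2 = r" "(r + s + j - (r - s)) div 2 = s" for r s
        using j by presburger+
      then show "(\<lambda>(m, n). ((m + n) div 2, (m - n) div 2)) (?g p) = p" for p
        by (simp split: prod.split)
      have "(m + n) div 2 + (m - n) div 2 + j = m" "(m + n) div 2 - (m - n) div 2 = n"
        if "(m + n) mod 2 = j" for m n
        using that j by presburger+
      then show "?g ((\<lambda>(m, n). ((m + n) div 2, (m - n) div 2)) p) = p" if "p \<in> {(m, n). (m + n) mod 2 = j}" for p
        using that by (cases p) simp
    qed auto
    have "(case ?g p of (m, n) \<Rightarrow> t \<tau> a (x + y) m * t \<tau> b (x - y) n) =
        (case p of (r, s) \<Rightarrow> t (2 * \<tau>) ((of_int j + a + b) / 2) (2 * x) r * t (2 * \<tau>) ((of_int j + a - b) / 2) (2 * y) s)" for p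
    proof (cases p)
      case (Pair r s)
      define R S where "R = of_int r + (of_int j + a + b) / 2" and "S = of_int s + (of_int j + a - b) / 2"
      have "of_int (r + s + j) + a = R + S" "of_int (r - s) + b = R - S"
        by (simp_all add: R_def S_def field_simps)
      moreover have "exp (pii * (R + S)\<^sup>2 * \<tau> + 2 * pii * (R + S) * (x + y)) *
            exp (pii * (R - S)\<^sup>2 * \<tau> + 2 * pii * (R - S) * (x - y)) =
          exp (pii * R\<^sup>2 * (2 * \<tau>) + 2 * pii * R * (2 * x)) * exp (pii * S\<^sup>2 * (2 * \<tau>) + 2 * pii * S * (2 * y))"
        unfolding exp_add[symmetric]
        by (rule arg_cong[where f = exp]) (simp add: power2_eq_square algebra_simps)
      ultimately show ?thesis
        unfolding Pair t_def R_def[symmetric] S_def[symmetric] prod.case by (simp only:)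
    qed
    moreover have "Im (2 * \<tau>) > 0" using assms by simp
    ultimately show ?thesis
      unfolding has_sum_reindex_bij_betw[OF bij, symmetric] by (simp add: prod)
  qed
  have "((\<lambda>(m, n). t \<tau> a (x + y) m * t \<tau> b (x - y) n) has_sum
     (theta_char (2 * \<tau>) ((a + b) / 2) (2 * x) * theta_char (2 * \<tau>) ((a - b) / 2) (2 * y) +
    theta_char (2 * \<tau>) ((1 + a + b) / 2) (2 * x) * theta_char (2 * \<tau>) ((1 + a - b) / 2) (2 * y)))
     ({(m, n). (m + n) mod 2 = 0} \<union> {(m, n). (m + n) mod 2 = 1})"
    by (rule has_sum_Un_disjoint) (use part[of 0] part[of 1] in auto)
  moreover have "{(m, n). (m + n) mod 2 = 0} \<union> {(m, n). (m + n) mod 2 = 1} = (UNIV :: (int \<times> int) set)"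
    by auto
  ultimately show ?thesis
    using prod[OF assms, of a "x + y" b "x - y"] has_sum_unique by metis
qed

section \<open>Theta constants\<close>

text \<open>The four classical theta functions. In Jacobi's numbering they are
  \<open>\<theta>\<^sub>3\<close>, \<open>\<theta>\<^sub>4\<close>, \<open>\<theta>\<^sub>2\<close> and \<open>- \<theta>\<^sub>1\<close>; only the last one is odd.\<close>

abbreviation "th00 \<tau> z \<equiv> theta_char \<tau> 0 z"
abbreviation "th01 \<tau> z \<equiv> theta_char \<tau> 0 (z + 1 / 2)"
abbreviation "th10 \<tau> z \<equiv> theta_char \<tau> (1 / 2) z"
abbreviation "th11 \<tau> z \<equiv> theta_char \<tau> (1 / 2) (z + 1 / 2)"

lemma exp_pii_half: "exp (pii / 2) = \<i>" "exp (pii * 3 / 2) = - \<i>"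
proof -
  show "exp (pii / 2) = \<i>"
    by (simp add: exp_eq_polar complex_eq_iff cis.code)
  then have "exp (pii / 2 + pii) = - \<i>"
    by (simp only: exp_add) simp
  then show "exp (pii * 3 / 2) = - \<i>"
    by (simp add: field_simps)
qed

text \<open>For real \<open>a\<close> and \<open>z\<close> the variable \<open>w\<close> of the triple product has modulus \<open>norm q powr (2 * a)\<close>,
  where \<open>q\<close> is the nome. So for \<open>\<bar>a\<bar> < 1 / 2\<close> both \<open>q * w\<close> and \<open>q / w\<close> lie inside the unit disc and no factor vanishes.\<close>

lemma theta_char_real_nonzero:
  fixes a z :: real
  assumes "Im \<tau> > 0" "\<bar>a\<bar> < 1 / 2"
  shows "theta_char \<tau> (of_real a) (of_real z) \<noteq> 0"
proof -
  define q w where "q = exp (pii * \<tau>)" and "w = exp (2 * pii * (of_real z + of_real a * \<tau>))"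
  have q: "norm (q\<^sup>2) < 1"
    unfolding q_def by (rule norm_power2_less_1[OF norm_nome_less_1[OF assms(1)]])
  have small: "norm (y * (q\<^sup>2) ^ n) < 1" if "norm y < 1" for y n
  proof -
    have "norm y * norm (q\<^sup>2) ^ n \<le> norm y"
      using q by (intro mult_left_le power_le_one) auto
    then show ?thesis
      using that by (simp add: norm_mult norm_power)
  qed
  have "0 < 1 + 2 * a" "0 < 1 - 2 * a"
    using assms(2) by auto
  then have *: "0 < pi * Im \<tau> * (1 + 2 * a)" "0 < pi * Im \<tau> * (1 - 2 * a)"
    using assms(1) by auto
  have 1: "norm (- (q * w)) < 1"
    using *(1) by (simp add: q_def w_def norm_mult exp_add[symmetric] algebra_simps)
  have 2: "norm (- (q / w)) < 1"
    using *(2) by (simp add: q_def w_def norm_divide exp_diff[symmetric] algebra_simps)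
  have "qprod (q\<^sup>2) y \<noteq> 0" if "norm y < 1" for y
    by (rule qprod_nonzero[OF q]) (use small[OF that] in \<open>metis less_irrefl norm_one\<close>)
  from this[OF 1] this[OF 2] show ?thesis
    unfolding theta_char_product_formula[OF assms(1)] q_def[symmetric] w_def[symmetric]
    using qprod_self_nonzero[OF q] by simp
qed

lemma theta_char_has_deriv:
  assumes "Im \<tau> > 0"
  shows "(theta_char \<tau> a has_field_derivative deriv (theta_char \<tau> a) z) (at z)"
  using holomorphic_theta_char[OF assms] by (rule holomorphic_derivI) auto

text \<open>The odd theta function is a simple factor vanishing at the origin times a holomorphic \<open>h\<close>,
  so its derivative there is a value of \<open>h\<close> up to a constant. As \<open>th11\<close> is a translate by one half,
  the origin corresponds to the argument \<open>1 / 2\<close> of \<open>theta_char\<close>.\<close>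

lemma
  assumes "Im \<tau> > 0"
  defines "q \<equiv> exp (pii * \<tau>)"
  shows th00_null: "th00 \<tau> 0 = qprod (q\<^sup>2) (q\<^sup>2) * qprod (q\<^sup>2) (- q) ^ 2"
    and th01_null: "th01 \<tau> 0 = qprod (q\<^sup>2) (q\<^sup>2) * qprod (q\<^sup>2) q ^ 2"
    and th10_null: "th10 \<tau> 0 = 2 * exp (pii * \<tau> / 4) * qprod (q\<^sup>2) (q\<^sup>2) * qprod (q\<^sup>2) (- (q\<^sup>2)) ^ 2"
    and th11_deriv_null: "deriv (theta_char \<tau> (1 / 2)) (1 / 2) = - 2 * of_real pi * exp (pii * \<tau> / 4) * qprod (q\<^sup>2) (q\<^sup>2) ^ 3"
proof -
  have q2: "norm (q\<^sup>2) < 1"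
    unfolding q_def by (rule norm_power2_less_1[OF norm_nome_less_1[OF assms(1)]])
  have q0: "q \<noteq> 0" by (simp add: q_def)
  note product = theta_char_product_formula[OF assms(1), folded q_def]
  show "th00 \<tau> 0 = qprod (q\<^sup>2) (q\<^sup>2) * qprod (q\<^sup>2) (- q) ^ 2"
    by (simp add: product power2_eq_square)
  show "th01 \<tau> 0 = qprod (q\<^sup>2) (q\<^sup>2) * qprod (q\<^sup>2) q ^ 2"
    by (simp add: product power2_eq_square)
  have half: "exp (2 * pii * (1 / 2 * \<tau>)) = q"
    by (simp add: q_def mult_ac)
  have "th10 \<tau> 0 = exp (pii * \<tau> / 4) * (qprod (q\<^sup>2) (q\<^sup>2) * qprod (q\<^sup>2) (- (q\<^sup>2)) * qprod (q\<^sup>2) (- 1))"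
    unfolding product add_0_left half using q0 by (simp add: power2_eq_square)
  then show "th10 \<tau> 0 = 2 * exp (pii * \<tau> / 4) * qprod (q\<^sup>2) (q\<^sup>2) * qprod (q\<^sup>2) (- (q\<^sup>2)) ^ 2"
    using qprod_rec[OF q2, of "- 1"] by (simp add: power2_eq_square)
  define h where "h = (\<lambda>z. exp (pii * \<tau> / 4 + pii * z) * (qprod (q\<^sup>2) (q\<^sup>2) *
     qprod (q\<^sup>2) (- (q\<^sup>2 * exp (2 * pii * z))) * qprod (q\<^sup>2) (- (q\<^sup>2 / exp (2 * pii * z)))))"
  have factor: "theta_char \<tau> (1 / 2) z = (1 + exp (- (2 * pii * z))) * h z" for z
  proof -
    have w: "exp (2 * pii * (z + 1 / 2 * \<tau>)) = q * exp (2 * pii * z)"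
      by (simp add: q_def exp_add[symmetric] algebra_simps)
    have "theta_char \<tau> (1 / 2) z = exp (pii * \<tau> / 4 + pii * z) * (qprod (q\<^sup>2) (q\<^sup>2) *
        qprod (q\<^sup>2) (- (q\<^sup>2 * exp (2 * pii * z))) * qprod (q\<^sup>2) (- (1 / exp (2 * pii * z))))"
      unfolding product w using q0 by (simp add: power2_eq_square algebra_simps)
    also have "qprod (q\<^sup>2) (- (1 / exp (2 * pii * z))) =
        (1 + exp (- (2 * pii * z))) * qprod (q\<^sup>2) (- (q\<^sup>2 / exp (2 * pii * z)))"
      by (subst qprod_rec[OF q2]) (simp add: exp_minus field_simps)
    finally show ?thesis by (simp add: h_def mult_ac)
  qed
  have "qprod (q\<^sup>2) \<circ> f holomorphic_on UNIV" if "f holomorphic_on UNIV" for f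
    using holomorphic_on_compose_gen[OF that holomorphic_qprod[OF q2]] by blast
  then have *: "(\<lambda>z. qprod (q\<^sup>2) (f z)) holomorphic_on UNIV" if "f holomorphic_on UNIV" for f
    using that by (simp add: o_def)
  have "h holomorphic_on UNIV"
    unfolding h_def by (intro holomorphic_intros *) auto
  then have "(h has_field_derivative deriv h (1 / 2)) (at (1 / 2))"
    by (rule holomorphic_derivI) auto
  moreover have "((\<lambda>z. 1 + exp (- (2 * pii * z))) has_field_derivative 2 * pii) (at (1 / 2))"
    by (auto intro!: derivative_eq_intros simp: exp_minus)
  ultimately have "((\<lambda>z. (1 + exp (- (2 * pii * z))) * h z) has_field_derivative
      (1 + exp (- (2 * pii * (1 / 2)))) * deriv h (1 / 2) + 2 * pii * h (1 / 2)) (at (1 / 2))"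
    by (intro DERIV_mult')
  then have "deriv (theta_char \<tau> (1 / 2)) (1 / 2) = 2 * pii * h (1 / 2)"
    unfolding factor[symmetric] by (intro DERIV_imp_deriv) (simp add: exp_minus)
  also have "h (1 / 2) = \<i> * exp (pii * \<tau> / 4) * qprod (q\<^sup>2) (q\<^sup>2) ^ 3"
    by (simp add: h_def exp_add exp_pii_half power3_eq_cube)
  finally show "deriv (theta_char \<tau> (1 / 2)) (1 / 2) = - 2 * of_real pi * exp (pii * \<tau> / 4) * qprod (q\<^sup>2) (q\<^sup>2) ^ 3"
    by simp
qed

text \<open>In product form the two sides differ exactly by the square of Euler's product.\<close>

lemma jacobi_derivative_formula:
  assumes "Im \<tau> > 0"
  shows "deriv (theta_char \<tau> (1 / 2)) (1 / 2) = - of_real pi * th00 \<tau> 0 * th01 \<tau> 0 * th10 \<tau> 0"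
proof -
  define q where "q = exp (pii * \<tau>)"
  let ?P = "qprod (q\<^sup>2)"
  have "?P q * ?P (- q) * ?P (- (q\<^sup>2)) = 1"
    unfolding q_def by (rule euler_product_identity[OF norm_nome_less_1[OF assms]])
  then have "(?P q * ?P (- q) * ?P (- (q\<^sup>2))) ^ 2 = 1"
    by simp
  then have "- 2 * of_real pi * exp (pii * \<tau> / 4) * ?P (q\<^sup>2) ^ 3
      = - 2 * of_real pi * exp (pii * \<tau> / 4) * ?P (q\<^sup>2) ^ 3 * (?P q * ?P (- q) * ?P (- (q\<^sup>2))) ^ 2"
    by simp
  then show ?thesis
    unfolding th00_null[OF assms] th01_null[OF assms] th10_null[OF assms] th11_deriv_null[OF assms]
      q_def[symmetric]
    by (simp add: power2_eq_square power3_eq_cube mult_ac)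
qed

lemma th10_null_nonzero:
  assumes "Im \<tau> > 0"
  shows "th10 \<tau> 0 \<noteq> 0"
proof -
  let ?q = "exp (pii * \<tau>)"
  have "norm (?q\<^sup>2) < 1"
    by (rule norm_power2_less_1[OF norm_nome_less_1[OF assms]])
  moreover have "qprod (?q\<^sup>2) (- (?q\<^sup>2)) \<noteq> 0"
    using euler_product_identity[OF norm_nome_less_1[OF assms]] by (metis mult_zero_right zero_neq_one)
  ultimately show ?thesis
    unfolding th10_null[OF assms] using qprod_self_nonzero by simp
qed

lemma
  assumes "Im \<tau> > 0"
  shows th00_null_nonzero: "th00 \<tau> 0 \<noteq> 0" and th01_null_nonzero: "th01 \<tau> 0 \<noteq> 0"
  using theta_char_real_nonzero[OF assms, of 0 0] theta_char_real_nonzero[OF assms, of 0 "1 / 2"] by simp_all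

section \<open>Addition formulas\<close>

lemma
  shows th01_minus: "th01 \<tau> (- z) = th01 \<tau> z" and th11_minus: "th11 \<tau> (- z) = - th11 \<tau> z"
proof -
  have "th01 \<tau> (- z) = theta_char \<tau> 0 (- z - 1 / 2 + 1)"
    by (simp add: algebra_simps)
  also have "\<dots> = theta_char \<tau> 0 (- (z + 1 / 2))"
    by (subst theta_char_plus_1) (simp add: algebra_simps)
  finally show "th01 \<tau> (- z) = th01 \<tau> z"
    by (simp only: theta_char_minus) simp
  have "th11 \<tau> (- z) = theta_char \<tau> (1 / 2) (- z - 1 / 2 + 1)"
    by (simp add: algebra_simps)
  also have "\<dots> = - theta_char \<tau> (1 / 2) (- (z + 1 / 2))"
    by (subst theta_char_plus_1) (simp add: algebra_simps)
  also have "\<dots> = - theta_char \<tau> (- (1 / 2) + 1) (z + 1 / 2)"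
    by (simp only: theta_char_minus theta_char_characteristic_plus_1)
  finally show "th11 \<tau> (- z) = - th11 \<tau> z"
    by simp
qed

text \<open>Adding 1 to the doubled argument multiplies \<open>A\<close>, \<open>B\<close>, \<open>C\<close>, \<open>D\<close> by \<open>1\<close>, \<open>-1\<close>, \<open>\<i>\<close>, \<open>-\<i>\<close>; this is the
  source of all signs.\<close>

lemma
  assumes "Im \<tau> > 0"
  defines "A \<equiv> (\<lambda>x. theta_char (2 * \<tau>) 0 (2 * x))" and "B \<equiv> (\<lambda>x. theta_char (2 * \<tau>) (1 / 2) (2 * x))"
    and "C \<equiv> (\<lambda>x. theta_char (2 * \<tau>) (1 / 4) (2 * x))" and "D \<equiv> (\<lambda>x. theta_char (2 * \<tau>) (3 / 4) (2 * x))"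
  shows th01_th01: "th01 \<tau> (x + y) * th01 \<tau> (x - y) = A x * A y - B x * B y"
    and th11_th11: "th11 \<tau> (x + y) * th11 \<tau> (x - y) = A x * B y - B x * A y"
    and th11_th01: "th11 \<tau> (x + y) * th01 \<tau> (x - y) = \<i> * (C x * C y - D x * D y)"
    and th10_th00: "th10 \<tau> (x + y) * th00 \<tau> (x - y) = C x * C y + D x * D y"
proof -
  note mult = theta_char_mult[OF assms(1)]
  have exp_pii_2: "exp (2 * pii) = 1"
    using exp_two_pi_i' by (simp only: mult_ac)
  have shift: "x + y + 1 / 2 = (x + 1 / 2) + y" "x - y + 1 / 2 = (x + 1 / 2) - y" "2 * (x + 1 / 2) = 2 * x + 1"
    by (simp_all add: algebra_simps)
  have fourth: "exp (2 * pii * ((1 / 2 + 0) / 2)) = \<i>" "exp (2 * pii * ((1 + 1 / 2 + 0) / 2)) = - \<i>"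
    using exp_pii_half by (simp_all add: mult_ac)
  have [simp]: "theta_char (2 * \<tau>) 1 z = theta_char (2 * \<tau>) 0 z" for z
    using theta_char_characteristic_plus_1[of "2 * \<tau>" 0 z] by simp
  show "th01 \<tau> (x + y) * th01 \<tau> (x - y) = A x * A y - B x * B y"
    unfolding shift(1,2) mult unfolding shift(3) theta_char_plus_1 by (simp add: A_def B_def)
  show "th11 \<tau> (x + y) * th11 \<tau> (x - y) = A x * B y - B x * A y"
    unfolding shift(1,2) mult unfolding shift(3) theta_char_plus_1
    by (simp add: A_def B_def exp_pii_2)
  show "th11 \<tau> (x + y) * th01 \<tau> (x - y) = \<i> * (C x * C y - D x * D y)"
    unfolding shift(1,2) mult unfolding shift(3) theta_char_plus_1 fourth
    by (simp add: C_def D_def right_diff_distrib)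
  show "th10 \<tau> (x + y) * th00 \<tau> (x - y) = C x * C y + D x * D y"
    unfolding mult by (simp add: C_def D_def)
qed

text \<open>With \<open>s = th11 / th01\<close>, a multiple of Jacobi's \<open>sn\<close>, the quotient of these two formulas reads
  \<open>s (x + y) * s (x - y) = (s x ^ 2 - s y ^ 2) / (1 - s x ^ 2 * s y ^ 2)\<close>.\<close>

lemma
  assumes "Im \<tau> > 0"
  shows th01_addition: "th01 \<tau> (x + y) * th01 \<tau> (x - y) * th01 \<tau> 0 ^ 2
      = th01 \<tau> x ^ 2 * th01 \<tau> y ^ 2 - th11 \<tau> x ^ 2 * th11 \<tau> y ^ 2"
    and th11_addition: "th11 \<tau> (x + y) * th11 \<tau> (x - y) * th01 \<tau> 0 ^ 2
      = th11 \<tau> x ^ 2 * th01 \<tau> y ^ 2 - th01 \<tau> x ^ 2 * th11 \<tau> y ^ 2"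
proof -
  define A B where "A = (\<lambda>x. theta_char (2 * \<tau>) 0 (2 * x))" and "B = (\<lambda>x. theta_char (2 * \<tau>) (1 / 2) (2 * x))"
  have AB: "A z = theta_char (2 * \<tau>) 0 (2 * z)" "B z = theta_char (2 * \<tau>) (1 / 2) (2 * z)" for z
    by (simp_all add: A_def B_def)
  note v = th01_th01[OF assms, folded AB] th11_th11[OF assms, folded AB]
  have sq: "th01 \<tau> z ^ 2 = A z * A 0 - B z * B 0" "th11 \<tau> z ^ 2 = A z * B 0 - B z * A 0" for z
    using v[of z 0] by (simp_all add: power2_eq_square)
  show "th01 \<tau> (x + y) * th01 \<tau> (x - y) * th01 \<tau> 0 ^ 2
      = th01 \<tau> x ^ 2 * th01 \<tau> y ^ 2 - th11 \<tau> x ^ 2 * th11 \<tau> y ^ 2"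
    unfolding v sq by (simp add: algebra_simps)
  show "th11 \<tau> (x + y) * th11 \<tau> (x - y) * th01 \<tau> 0 ^ 2
      = th11 \<tau> x ^ 2 * th01 \<tau> y ^ 2 - th01 \<tau> x ^ 2 * th11 \<tau> y ^ 2"
    unfolding v sq by (simp add: algebra_simps)
qed

lemma theta_char_deriv_chain:
  assumes "Im \<tau> > 0" "(f has_field_derivative f') (at z)"
  shows "((\<lambda>z. theta_char \<tau> a (f z)) has_field_derivative deriv (theta_char \<tau> a) (f z) * f') (at z)"
  by (rule DERIV_chain2[OF theta_char_has_deriv[OF assms(1)] assms(2)])

lemma th11_0: "th11 \<tau> 0 = 0"
  using th11_minus[of \<tau> 0] by simp

text \<open>This is the derivative formula \<open>sn' = cn * dn\<close> in terms of theta functions. Differentiating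
  \<open>th11 (x + y) * th01 (x - y)\<close> in \<open>y\<close> at the origin produces the Wronskian on one side. On the other
  side \<open>D y = C (- y)\<close>, so that their derivatives at 0 are opposite and the difference
  \<open>C x * C y - D x * D y\<close> becomes a multiple of \<open>C x + D x\<close>, which is \<open>th10 x * th00 x\<close> up to a constant.
  The argument \<open>x = 0\<close> fixes the constant.\<close>

lemma theta_wronskian:
  assumes "Im \<tau> > 0"
  shows "(deriv (theta_char \<tau> (1 / 2)) (x + 1 / 2) * th01 \<tau> x - th11 \<tau> x * deriv (theta_char \<tau> 0) (x + 1 / 2))
      * (th10 \<tau> 0 * th00 \<tau> 0)
    = deriv (theta_char \<tau> (1 / 2)) (1 / 2) * th01 \<tau> 0 * (th10 \<tau> x * th00 \<tau> x)"
proof -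
  define C where "C = (\<lambda>x. theta_char (2 * \<tau>) (1 / 4) (2 * x))"
  define D where "D = (\<lambda>x. theta_char (2 * \<tau>) (3 / 4) (2 * x))"
  define c where "c = 2 * deriv (theta_char (2 * \<tau>) (1 / 4)) 0"
  have CD: "C z = theta_char (2 * \<tau>) (1 / 4) (2 * z)" "D z = theta_char (2 * \<tau>) (3 / 4) (2 * z)" for z
    by (simp_all add: C_def D_def)
  have DC: "D y = theta_char (2 * \<tau>) (1 / 4) (- (2 * y))" for y
    using theta_char_characteristic_plus_1[of "2 * \<tau>" "- (1 / 4)" "2 * y"]
    unfolding D_def theta_char_minus by simp
  have tau2: "Im (2 * \<tau>) > 0" using assms by simp
  have C': "(C has_field_derivative c) (at 0)"
    unfolding C_def c_def by (auto intro!: derivative_eq_intros theta_char_deriv_chain[THEN DERIV_cong, OF tau2])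
  have D': "(D has_field_derivative - c) (at 0)"
    unfolding DC c_def by (auto intro!: derivative_eq_intros theta_char_deriv_chain[THEN DERIV_cong, OF tau2])
  let ?W = "\<lambda>x. deriv (theta_char \<tau> (1 / 2)) (x + 1 / 2) * th01 \<tau> x - th11 \<tau> x * deriv (theta_char \<tau> 0) (x + 1 / 2)"
  have W: "?W x = \<i> * c * (C x + D x)" for x
  proof (rule DERIV_unique)
    show "((\<lambda>y. th11 \<tau> (x + y) * th01 \<tau> (x - y)) has_field_derivative ?W x) (at 0)"
      by (auto intro!: derivative_eq_intros theta_char_deriv_chain[THEN DERIV_cong, OF assms])
    have "((\<lambda>y. \<i> * (C x * C y - D x * D y)) has_field_derivative \<i> * c * (C x + D x)) (at 0)"
      by (auto intro!: derivative_eq_intros C' D' simp: algebra_simps)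
    then show "((\<lambda>y. th11 \<tau> (x + y) * th01 \<tau> (x - y)) has_field_derivative \<i> * c * (C x + D x)) (at 0)"
      unfolding th11_th01[OF assms, folded CD] .
  qed
  have D0: "D 0 = C 0"
    unfolding DC by (simp add: C_def)
  have even: "th10 \<tau> x * th00 \<tau> x = C 0 * (C x + D x)" for x
    using th10_th00[OF assms, of x 0, folded CD] by (simp add: D0 algebra_simps)
  have "deriv (theta_char \<tau> (1 / 2)) (1 / 2) * th01 \<tau> 0 = \<i> * c * (C 0 + C 0)"
    using W[of 0] by (simp add: D0 th11_0[simplified])
  then show ?thesis
    unfolding W even D0 by (simp add: algebra_simps)
qed


section \<open>Logarithmic derivatives at a 3-torsion point\<close>

lemma
  fixes \<tau> v :: complex
  defines "m \<equiv> exp (2 * pii * v - pii * \<tau>)"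
  shows th01_quasi_period: "th01 \<tau> (v + 1 - \<tau>) = - m * th01 \<tau> v"
    and th11_quasi_period: "th11 \<tau> (v + 1 - \<tau>) = m * th11 \<tau> v"
proof -
  have arg: "v + 1 - \<tau> + 1 / 2 = (v + 1 / 2 + - 1 * \<tau>) + 1"
    by (simp add: algebra_simps)
  have m: "exp (- pii * ((- 1)\<^sup>2 * \<tau> + 2 * - 1 * (v + 1 / 2))) = - m"
  proof -
    have "exp (- pii * ((- 1)\<^sup>2 * \<tau> + 2 * - 1 * (v + 1 / 2))) = exp ((2 * pii * v - pii * \<tau>) + pii)"
      by (rule arg_cong[where f = exp]) (simp add: algebra_simps)
    then show ?thesis
      unfolding exp_add m_def by simp
  qed
  show "th01 \<tau> (v + 1 - \<tau>) = - m * th01 \<tau> v"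
    using theta_char_characteristic_plus_1[of \<tau> "- 1" "v + 1 / 2"]
    unfolding arg theta_char_plus_1 theta_char_plus_period m by simp
  show "th11 \<tau> (v + 1 - \<tau>) = m * th11 \<tau> v"
    using theta_char_characteristic_plus_1[of \<tau> "- (1 / 2)" "v + 1 / 2"]
    unfolding arg theta_char_plus_1 theta_char_plus_period m by simp
qed

text \<open>Write \<open>f = th01' / th01\<close> and \<open>s = th11 / th01\<close>. The logarithmic derivative of the addition formula of
  \<open>th01\<close> in \<open>x\<close>, combined with the derivative of the one of \<open>th11\<close>, gives at \<open>x = y = u\<close>
  \<open>f (2 * u) - 2 * f u = - (t / N) * s u ^ 2 * s (2 * u)\<close>. Since \<open>2 * u = - u + (1 - \<tau>)\<close>, parity and
  quasi-periodicity give \<open>f (2 * u) = 2 * pii - f u\<close> and \<open>s (2 * u) = s u\<close>, and one can solve for \<open>f u\<close>.\<close>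

lemma th01_log_deriv_torsion:
  fixes \<tau> :: complex
  assumes "Im \<tau> > 0"
  defines "u \<equiv> (1 - \<tau>) / 3"
  defines "a \<equiv> th01 \<tau> u" and "a' \<equiv> deriv (theta_char \<tau> 0) (u + 1 / 2)"
    and "b \<equiv> th11 \<tau> u" and "N \<equiv> th01 \<tau> 0"
    and "t \<equiv> deriv (theta_char \<tau> (1 / 2)) (1 / 2)"
  assumes "a \<noteq> 0" "b \<noteq> 0"
  shows "a' / a = 2 * pii / 3 + (t * b ^ 3) / (3 * N * a ^ 3)"
proof -
  define b' where "b' = deriv (theta_char \<tau> (1 / 2)) (u + 1 / 2)"
  \<comment> \<open>The common factor by which both theta functions change from \<open>u\<close> to \<open>2 * u\<close>.\<close>
  define K where "K = - exp (2 * pii * (- u) - pii * \<tau>)"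
  define d where "d = deriv (theta_char \<tau> 0) (2 * u + 1 / 2)"
  have N: "N \<noteq> 0"
    unfolding N_def by (rule th01_null_nonzero[OF assms(1)])
  have K: "K \<noteq> 0"
    by (simp add: K_def)
  have two_u: "2 * u = - u + 1 - \<tau>"
    by (simp add: u_def field_simps)
  have th01_2u: "th01 \<tau> (2 * u) = K * a"
    unfolding two_u th01_quasi_period by (simp only: K_def a_def th01_minus)
  have th11_2u: "th11 \<tau> (2 * u) = K * b"
    unfolding two_u th11_quasi_period by (simp only: K_def b_def th11_minus mult_minus_left mult_minus_right)
  note D = theta_char_deriv_chain[THEN DERIV_cong, OF assms(1)]
  have N': "deriv (theta_char \<tau> 0) (1 / 2) = 0"
  proof -
    have 1: "((\<lambda>z. th01 \<tau> (- z)) has_field_derivative - deriv (theta_char \<tau> 0) (1 / 2)) (at 0)"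
      by (auto intro!: derivative_eq_intros D)
    have 2: "((\<lambda>z. th01 \<tau> z) has_field_derivative deriv (theta_char \<tau> 0) (1 / 2)) (at 0)"
      by (auto intro!: derivative_eq_intros D)
    show ?thesis
      using DERIV_unique[OF 1[unfolded th01_minus] 2] by simp
  qed
  have d: "d = K * (2 * pii * a - a')"
  proof (rule DERIV_unique)
    show "((\<lambda>z. th01 \<tau> (2 * u + z)) has_field_derivative d) (at 0)"
      unfolding d_def by (auto intro!: derivative_eq_intros D)
    have eq: "th01 \<tau> (2 * u + z) = K * exp (2 * pii * z) * th01 \<tau> (u - z)" for z
    proof -
      have "th01 \<tau> (2 * u + z) = th01 \<tau> ((- (u - z)) + 1 - \<tau>)"
        unfolding two_u by (simp add: algebra_simps)
      also have "\<dots> = - exp (2 * pii * (- (u - z)) - pii * \<tau>) * th01 \<tau> (u - z)"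
        by (simp only: th01_quasi_period th01_minus)
      also have "exp (2 * pii * (- (u - z)) - pii * \<tau>) = - K * exp (2 * pii * z)"
        unfolding K_def minus_minus exp_add[symmetric]
        by (rule arg_cong[where f = exp]) (simp add: algebra_simps)
      finally show ?thesis by simp
    qed
    have "((\<lambda>z. K * exp (2 * pii * z) * th01 \<tau> (u - z)) has_field_derivative K * (2 * pii * a - a')) (at 0)"
      by (auto intro!: derivative_eq_intros D simp: a_def a'_def algebra_simps)
    then show "((\<lambda>z. th01 \<tau> (2 * u + z)) has_field_derivative K * (2 * pii * a - a')) (at 0)"
      unfolding eq .
  qed
  have duplication: "K * a * N ^ 3 = a ^ 4 - b ^ 4"
    using th01_addition[OF assms(1), of u u] th01_2u
    by (simp add: a_def b_def N_def mult_2 power2_eq_square eval_nat_numeral mult_ac)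
  have diffA: "d * N ^ 3 = 2 * a ^ 3 * a' - 2 * b ^ 3 * b'"
  proof (rule DERIV_unique)
    show "((\<lambda>z. th01 \<tau> (z + u) * th01 \<tau> (z - u) * th01 \<tau> 0 ^ 2) has_field_derivative d * N ^ 3) (at u)"
      by (auto intro!: derivative_eq_intros D simp: d_def N_def N' power3_eq_cube power2_eq_square)
    have "((\<lambda>z. th01 \<tau> z ^ 2 * th01 \<tau> u ^ 2 - th11 \<tau> z ^ 2 * th11 \<tau> u ^ 2)
        has_field_derivative 2 * a ^ 3 * a' - 2 * b ^ 3 * b') (at u)"
      by (auto intro!: derivative_eq_intros D
          simp: a_def a'_def b_def b'_def power3_eq_cube power2_eq_square)
    then show "((\<lambda>z. th01 \<tau> (z + u) * th01 \<tau> (z - u) * th01 \<tau> 0 ^ 2)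
        has_field_derivative 2 * a ^ 3 * a' - 2 * b ^ 3 * b') (at u)"
      unfolding th01_addition[OF assms(1)] .
  qed
  have diffB: "K * b * t * N ^ 2 = 2 * a * b * (b' * a - a' * b)"
  proof (rule DERIV_unique)
    show "((\<lambda>z. th11 \<tau> (z + u) * th11 \<tau> (z - u) * th01 \<tau> 0 ^ 2) has_field_derivative K * b * t * N ^ 2) (at u)"
      by (auto intro!: derivative_eq_intros D simp: N_def t_def th11_0[simplified] th11_2u)
    have "((\<lambda>z. th11 \<tau> z ^ 2 * th01 \<tau> u ^ 2 - th01 \<tau> z ^ 2 * th11 \<tau> u ^ 2)
        has_field_derivative 2 * a * b * (b' * a - a' * b)) (at u)"
      by (auto intro!: derivative_eq_intros D
          simp: a_def a'_def b_def b'_def power2_eq_square algebra_simps)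
    then show "((\<lambda>z. th11 \<tau> (z + u) * th11 \<tau> (z - u) * th01 \<tau> 0 ^ 2)
        has_field_derivative 2 * a * b * (b' * a - a' * b)) (at u)"
      unfolding th11_addition[OF assms(1)] .
  qed
  have diffB': "K * t * N ^ 2 = 2 * a * (b' * a - a' * b)"
    using diffB \<open>b \<noteq> 0\<close> by (simp add: mult_ac)
  \<comment> \<open>The combination of the three relations that eliminates \<open>b'\<close>.\<close>
  have "K * N ^ 2 * a * (2 * pii * a ^ 3 * N + t * b ^ 3)
      = a ^ 3 * (K * (2 * pii * a - a') * N ^ 3) + a' * a ^ 2 * (K * a * N ^ 3) + a * b ^ 3 * (K * t * N ^ 2)"
    by (simp add: algebra_simps eval_nat_numeral)
  also have "\<dots> = a ^ 3 * (2 * a ^ 3 * a' - 2 * b ^ 3 * b') + a' * a ^ 2 * (a ^ 4 - b ^ 4)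
      + a * b ^ 3 * (2 * a * (b' * a - a' * b))"
    unfolding diffA[unfolded d] duplication diffB' ..
  also have "\<dots> = 3 * a' * a ^ 2 * (a ^ 4 - b ^ 4)"
    by (simp add: algebra_simps eval_nat_numeral)
  also have "\<dots> = K * N ^ 2 * a * (3 * a' * a ^ 2 * N)"
    unfolding duplication[symmetric] by (simp add: algebra_simps eval_nat_numeral)
  finally have "K * N ^ 2 * a * (3 * a' * a ^ 2 * N) = K * N ^ 2 * a * (2 * pii * a ^ 3 * N + t * b ^ 3)" ..
  moreover have "K * N ^ 2 * a \<noteq> 0"
    using K N \<open>a \<noteq> 0\<close> by simp
  ultimately have key: "3 * a' * a ^ 2 * N = 2 * pii * a ^ 3 * N + t * b ^ 3"
    by (metis mult_left_cancel)
  have "a' / a = (3 * a' * a ^ 2 * N) / (3 * N * a ^ 3)"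
    using \<open>a \<noteq> 0\<close> N by (simp add: divide_simps eval_nat_numeral)
  also have "\<dots> = 2 * pii * (a ^ 3 * N) / (3 * (a ^ 3 * N)) + t * b ^ 3 / (3 * N * a ^ 3)"
    unfolding key add_divide_distrib by (simp add: mult_ac)
  also have "2 * pii * (a ^ 3 * N) / (3 * (a ^ 3 * N)) = 2 * pii / 3"
    using \<open>a \<noteq> 0\<close> N by simp
  finally show ?thesis .
qed

lemma zeta_root_3:
  "zeta_root 3 ^ 2 = exp (- (2 * pii / 3))" "zeta_root 3 ^ 3 = 1"
proof -
  have "exp (2 * pii) = 1"
    using exp_two_pi_i' by (simp only: mult_ac)
  moreover have "zeta_root 3 ^ 2 = exp (- (2 * pii / 3) + 2 * pii)"
    unfolding zeta_root_def exp_of_nat_mult[symmetric] by (rule arg_cong[where f = exp]) simp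
  ultimately show "zeta_root 3 ^ 2 = exp (- (2 * pii / 3))"
    unfolding exp_add by simp
  have "zeta_root 3 ^ 3 = exp (2 * pii)"
    unfolding zeta_root_def exp_of_nat_mult[symmetric] by (rule arg_cong[where f = exp]) simp
  then show "zeta_root 3 ^ 3 = 1"
    using \<open>exp (2 * pii) = 1\<close> by simp
qed

text \<open>All theta constants with characteristics in thirds that occur in the theorem are values of the four
  classical theta functions at the same 3-torsion point, up to exponential factors. For the
  first of them a whole neighbourhood of the point is needed because it gets differentiated.
  The even functions with \<open>a = 0\<close> are evaluated at \<open>- u\<close> to reach the characteristic \<open>1 / 3\<close> instead of
  \<open>- 1 / 3\<close>.\<close>

lemma
  fixes \<tau> :: complex
  defines "u \<equiv> (1 - \<tau>) / 3" and "p \<equiv> exp (pii * (5 / 9 - \<tau> / 9))" and "r \<equiv> exp (pii * (2 / 9 - \<tau> / 9))"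
  shows th11_torsion: "th11 \<tau> (\<zeta> + u) = p * exp (2 * pii / 3 * \<zeta>) * theta_char \<tau> (1 / 6) (\<zeta> + 5 / 6)"
    and th01_torsion: "th01 \<tau> u = p * zeta_root 3 ^ 2 * theta_char \<tau> (1 / 3) (1 / 6)"
    and th10_torsion: "th10 \<tau> u = r * theta_char \<tau> (1 / 6) (1 / 3)"
    and th00_torsion: "th00 \<tau> u = r * zeta_root 3 ^ 2 * theta_char \<tau> (1 / 3) (2 / 3)"
    and torsion_phases: "r ^ 2 = zeta_root 3 ^ 2 * p ^ 2"
proof -
  have wrap: "theta_char \<tau> (1 / 3) z = zeta_root 3 ^ 2 * theta_char \<tau> (1 / 3) (z + 1)" for z
    unfolding theta_char_plus_1 zeta_root_3 by (simp add: exp_minus)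
  have "th11 \<tau> (\<zeta> + u) = theta_char \<tau> (1 / 2) (\<zeta> + 5 / 6 + - (1 / 3) * \<tau>)"
    by (rule arg_cong[where f = "theta_char \<tau> (1 / 2)"]) (simp add: u_def field_simps)
  also have "\<dots> = exp (- pii * ((- (1 / 3))\<^sup>2 * \<tau> + 2 * - (1 / 3) * (\<zeta> + 5 / 6))) * theta_char \<tau> (1 / 6) (\<zeta> + 5 / 6)"
    unfolding theta_char_plus_period by simp
  also have "exp (- pii * ((- (1 / 3))\<^sup>2 * \<tau> + 2 * - (1 / 3) * (\<zeta> + 5 / 6))) = p * exp (2 * pii / 3 * \<zeta>)"
    unfolding p_def exp_add[symmetric] by (rule arg_cong[where f = exp]) (simp add: field_simps power2_eq_square)
  finally show "th11 \<tau> (\<zeta> + u) = p * exp (2 * pii / 3 * \<zeta>) * theta_char \<tau> (1 / 6) (\<zeta> + 5 / 6)" .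
  have "th01 \<tau> u = theta_char \<tau> 0 (- u + 1 / 2)"
    by (rule th01_minus[symmetric])
  also have "\<dots> = theta_char \<tau> 0 (1 / 6 + 1 / 3 * \<tau>)"
    by (simp add: u_def field_simps)
  also have "\<dots> = exp (- pii * ((1 / 3)\<^sup>2 * \<tau> + 2 * (1 / 3) * (1 / 6))) * theta_char \<tau> (1 / 3) (1 / 6)"
    unfolding theta_char_plus_period by simp
  also have "exp (- pii * ((1 / 3)\<^sup>2 * \<tau> + 2 * (1 / 3) * (1 / 6))) = p * zeta_root 3 ^ 2"
    unfolding p_def zeta_root_3 exp_add[symmetric] by (rule arg_cong[where f = exp]) (simp add: field_simps power2_eq_square)
  finally show "th01 \<tau> u = p * zeta_root 3 ^ 2 * theta_char \<tau> (1 / 3) (1 / 6)" .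
  have "th10 \<tau> u = theta_char \<tau> (1 / 2) (1 / 3 + - (1 / 3) * \<tau>)"
    by (simp add: u_def field_simps)
  also have "\<dots> = exp (- pii * ((- (1 / 3))\<^sup>2 * \<tau> + 2 * - (1 / 3) * (1 / 3))) * theta_char \<tau> (1 / 6) (1 / 3)"
    unfolding theta_char_plus_period by simp
  also have "exp (- pii * ((- (1 / 3))\<^sup>2 * \<tau> + 2 * - (1 / 3) * (1 / 3))) = r"
    unfolding r_def by (rule arg_cong[where f = exp]) (simp add: field_simps power2_eq_square)
  finally show "th10 \<tau> u = r * theta_char \<tau> (1 / 6) (1 / 3)" .
  have "th00 \<tau> u = theta_char \<tau> 0 (- u)"
    by (simp add: theta_char_minus)
  also have "\<dots> = theta_char \<tau> 0 (- (1 / 3) + 1 / 3 * \<tau>)"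
    by (rule arg_cong[where f = "theta_char \<tau> 0"]) (simp add: u_def field_simps)
  also have "\<dots> = exp (- pii * ((1 / 3)\<^sup>2 * \<tau> + 2 * (1 / 3) * - (1 / 3))) * theta_char \<tau> (1 / 3) (- (1 / 3))"
    unfolding theta_char_plus_period by simp
  also have "exp (- pii * ((1 / 3)\<^sup>2 * \<tau> + 2 * (1 / 3) * - (1 / 3))) = r"
    unfolding r_def by (rule arg_cong[where f = exp]) (simp add: field_simps power2_eq_square)
  also have "theta_char \<tau> (1 / 3) (- (1 / 3)) = zeta_root 3 ^ 2 * theta_char \<tau> (1 / 3) (2 / 3)"
    using wrap[of "- (1 / 3)"] by simp
  finally show "th00 \<tau> u = r * zeta_root 3 ^ 2 * theta_char \<tau> (1 / 3) (2 / 3)"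
    by (simp add: mult.assoc)
  show "r ^ 2 = zeta_root 3 ^ 2 * p ^ 2"
    unfolding r_def p_def zeta_root_3 exp_of_nat_mult[symmetric] exp_add[symmetric]
    by (rule arg_cong[where f = exp]) (simp add: field_simps)
qed

text \<open>The logarithmic derivative of \<open>th11\<close> at \<open>u\<close> is that of \<open>th01\<close> plus the Wronskian divided by
  \<open>th11 u * th01 u\<close>. The exponential factor between \<open>th11\<close> and the function with characteristics
  contributes \<open>- 2 * pii / 3\<close>, which cancels the constant in the logarithmic derivative of \<open>th01\<close>.\<close>

lemma theta_log_deriv_torsion:
  fixes \<tau> :: complex
  assumes "Im \<tau> > 0"
  defines "X \<equiv> theta_char \<tau> (1 / 6) (5 / 6)" and "Y \<equiv> theta_char \<tau> (1 / 3) (1 / 6)"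
    and "Z \<equiv> theta_char \<tau> (1 / 6) (1 / 3)" and "V \<equiv> theta_char \<tau> (1 / 3) (2 / 3)"
    and "t \<equiv> deriv (theta_char \<tau> (1 / 2)) (1 / 2)"
  shows "deriv (theta_char \<tau> (1 / 6)) (5 / 6) / X = 1 / 3 * (t * X ^ 3 / (th01 \<tau> 0 * Y ^ 3))
     + zeta_root 3 ^ 2 * (t * th01 \<tau> 0 * Z * V / (th00 \<tau> 0 * th10 \<tau> 0 * X * Y))"
proof -
  define u where "u = (1 - \<tau>) / 3"
  define p r where "p = exp (pii * (5 / 9 - \<tau> / 9))" and "r = exp (pii * (2 / 9 - \<tau> / 9))"
  define w where "w = zeta_root 3 ^ 2"
  define a b a' b' where "a = th01 \<tau> u" and "b = th11 \<tau> u"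
    and "a' = deriv (theta_char \<tau> 0) (u + 1 / 2)" and "b' = deriv (theta_char \<tau> (1 / 2)) (u + 1 / 2)"
  define N where "N = th01 \<tau> 0"
  have nz: "X \<noteq> 0" "Y \<noteq> 0" "p \<noteq> 0" "w \<noteq> 0" "N \<noteq> 0" "th00 \<tau> 0 \<noteq> 0" "th10 \<tau> 0 \<noteq> 0"
    using theta_char_real_nonzero[OF assms(1), of "1 / 6" "5 / 6"]
      theta_char_real_nonzero[OF assms(1), of "1 / 3" "1 / 6"] th01_null_nonzero[OF assms(1)]
      th00_null_nonzero[OF assms(1)] th10_null_nonzero[OF assms(1)]
    by (simp_all add: X_def Y_def p_def w_def N_def zeta_root_def)
  have w3: "w ^ 3 = 1"
    using zeta_root_3(2) unfolding w_def by (metis power_mult mult.commute power_one)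
  note torsion = th11_torsion[of \<tau>, folded u_def p_def] th01_torsion[of \<tau>, folded u_def p_def w_def Y_def]
    th10_torsion[of \<tau>, folded u_def r_def Z_def] th00_torsion[of \<tau>, folded u_def r_def w_def V_def]
    torsion_phases[of \<tau>, folded p_def r_def w_def]
  have b: "b = p * X"
    using torsion(1)[of 0] by (simp add: b_def X_def)
  have a: "a = p * w * Y"
    unfolding a_def torsion(2) ..
  have ab: "a \<noteq> 0" "b \<noteq> 0"
    using nz(1-4) by (simp_all add: a b)
  have "b' = p * (deriv (theta_char \<tau> (1 / 6)) (5 / 6) + 2 * pii / 3 * X)"
  proof (rule DERIV_unique)
    note D = theta_char_deriv_chain[THEN DERIV_cong, OF assms(1)]
    show "((\<lambda>\<zeta>. th11 \<tau> (\<zeta> + u)) has_field_derivative b') (at 0)"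
      unfolding b'_def by (auto intro!: derivative_eq_intros D)
    have "((\<lambda>\<zeta>. p * exp (2 * pii / 3 * \<zeta>) * theta_char \<tau> (1 / 6) (\<zeta> + 5 / 6)) has_field_derivative
        p * (deriv (theta_char \<tau> (1 / 6)) (5 / 6) + 2 * pii / 3 * X)) (at 0)"
      by (auto intro!: derivative_eq_intros D simp: X_def algebra_simps)
    then show "((\<lambda>\<zeta>. th11 \<tau> (\<zeta> + u)) has_field_derivative
        p * (deriv (theta_char \<tau> (1 / 6)) (5 / 6) + 2 * pii / 3 * X)) (at 0)"
      unfolding torsion(1) .
  qed
  then have "deriv (theta_char \<tau> (1 / 6)) (5 / 6) / X = b' / b - 2 * pii / 3"
    using nz(1,3) by (simp add: b field_simps)
  moreover have "b' / b = a' / a + t * N * (th10 \<tau> u * th00 \<tau> u) / (th10 \<tau> 0 * th00 \<tau> 0 * (a * b))"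
  proof -
    have solve: "b' / b = a' / a + R / (H * (a * b))" if "(b' * a - b * a') * H = R" "H \<noteq> 0" for R H
      using that ab by (auto simp: field_simps)
    show ?thesis
      using nz theta_wronskian[OF assms(1), of u]
      by (intro solve) (simp_all add: a_def b_def a'_def b'_def t_def N_def)
  qed
  moreover have "t * N * (th10 \<tau> u * th00 \<tau> u) / (th10 \<tau> 0 * th00 \<tau> 0 * (a * b))
      = w * (t * N * Z * V / (th00 \<tau> 0 * th10 \<tau> 0 * X * Y))"
  proof -
    have "th10 \<tau> u * th00 \<tau> u = r ^ 2 * w * (Z * V)"
      unfolding torsion(3,4) by (simp add: power2_eq_square)
    also have "\<dots> = p ^ 2 * w * (w * (Z * V))"
      unfolding torsion(5) by (simp add: mult_ac)
    finally have cd: "th10 \<tau> u * th00 \<tau> u = p ^ 2 * w * (w * (Z * V))" .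
    have ab: "a * b = p ^ 2 * w * (X * Y)"
      by (simp add: a b power2_eq_square)
    have cancel: "c * (k * (w * (Z * V))) / (h * g * (k * (X * Y))) = w * (c * Z * V / (g * h * X * Y))"
      if "k \<noteq> 0" for c k h g :: complex
      using that by (simp add: mult_ac)
    show ?thesis
      unfolding cd ab by (rule cancel) (use nz in simp)
  qed
  moreover have "a' / a = 2 * pii / 3 + (t * b ^ 3) / (3 * N * a ^ 3)"
    using th01_log_deriv_torsion[OF assms(1), folded u_def, folded a_def a'_def b_def N_def t_def] ab
    by (simp only: simp_thms)
  moreover have "(t * b ^ 3) / (3 * N * a ^ 3) = 1 / 3 * (t * X ^ 3 / (N * Y ^ 3))"
    using nz(3) by (simp add: a b power_mult_distrib w3)
  ultimately have "deriv (theta_char \<tau> (1 / 6)) (5 / 6) / X = 2 * pii / 3 + 1 / 3 * (t * X ^ 3 / (N * Y ^ 3))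
      + w * (t * N * Z * V / (th00 \<tau> 0 * th10 \<tau> 0 * X * Y)) - 2 * pii / 3"
    by (simp only:)
  then show ?thesis
    unfolding N_def[symmetric] w_def[symmetric] by (simp only: add_diff_cancel_left' add.assoc)
qed

theorem theorem6p5:
  fixes \<tau> :: complex
  assumes "Im \<tau> > 0"
  defines "\<theta> \<equiv> theta_null \<tau>" and "\<theta>' \<equiv> theta_deriv_null \<tau>"
  shows "\<theta>' (1/3) (5/3) / \<theta> (1/3) (5/3) =
           1 / 3 * (\<theta>' 1 1 * \<theta> (1/3) (5/3) ^ 3 / (\<theta> 0 1 * \<theta> (2/3) (1/3) ^ 3))
           + zeta_root 3 ^ 2 *
             (\<theta>' 1 1 * \<theta> 0 1 * \<theta> (1/3) (2/3) * \<theta> (2/3) (4/3)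
              / (\<theta> 0 0 * \<theta> 1 0 * \<theta> (1/3) (5/3) * \<theta> (2/3) (1/3)))
         \<and> 1 / 3 * (\<theta>' 1 1 * \<theta> (1/3) (5/3) ^ 3 / (\<theta> 0 1 * \<theta> (2/3) (1/3) ^ 3))
           + zeta_root 3 ^ 2 *
             (\<theta>' 1 1 * \<theta> 0 1 * \<theta> (1/3) (2/3) * \<theta> (2/3) (4/3)
              / (\<theta> 0 0 * \<theta> 1 0 * \<theta> (1/3) (5/3) * \<theta> (2/3) (1/3))) =
         - (of_real pi / 3) * \<theta> 0 0 * \<theta> 1 0 * (\<theta> (1/3) (5/3) ^ 3 / \<theta> (2/3) (1/3) ^ 3)
           - of_real pi * zeta_root 3 ^ 2 * \<theta> 0 1 ^ 2 *
             (\<theta> (1/3) (2/3) * \<theta> (2/3) (4/3) / (\<theta> (1/3) (5/3) * \<theta> (2/3) (1/3)))"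
proof -
  have null: "\<theta> 0 0 = th00 \<tau> 0" "\<theta> 0 1 = th01 \<tau> 0" "\<theta> 1 0 = th10 \<tau> 0"
    "\<theta> (1/3) (5/3) = theta_char \<tau> (1 / 6) (5 / 6)" "\<theta> (2/3) (1/3) = theta_char \<tau> (1 / 3) (1 / 6)"
    "\<theta> (1/3) (2/3) = theta_char \<tau> (1 / 6) (1 / 3)" "\<theta> (2/3) (4/3) = theta_char \<tau> (1 / 3) (2 / 3)"
    by (simp_all add: \<theta>_def theta_null_def theta_eq_theta_char)
  have deriv_shift: "deriv (\<lambda>\<zeta>. theta_char \<tau> a (\<zeta> + c)) 0 = deriv (theta_char \<tau> a) c" for a c
    by (rule DERIV_imp_deriv)
       (auto intro!: derivative_eq_intros theta_char_deriv_chain[THEN DERIV_cong, OF assms(1)])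
  have derivs: "\<theta>' (1/3) (5/3) = deriv (theta_char \<tau> (1 / 6)) (5 / 6)"
    "\<theta>' 1 1 = deriv (theta_char \<tau> (1 / 2)) (1 / 2)"
    by (simp_all add: \<theta>'_def theta_deriv_null_def theta_eq_theta_char deriv_shift)
  have jacobi: "\<theta>' 1 1 = - of_real pi * \<theta> 0 0 * \<theta> 0 1 * \<theta> 1 0"
    unfolding null derivs by (rule jacobi_derivative_formula[OF assms(1)])
  have nz: "\<theta> 0 0 \<noteq> 0" "\<theta> 0 1 \<noteq> 0" "\<theta> 1 0 \<noteq> 0"
    unfolding null by (rule th00_null_nonzero th01_null_nonzero th10_null_nonzero, rule assms(1))+
  have cancel: "1 / 3 * (- pi' * A * B * C * X / (B * Y)) + w * (- pi' * A * B * C * B * Z * V / (A * C * P * Q))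
      = - (pi' / 3) * A * C * (X / Y) - pi' * w * B ^ 2 * (Z * V / (P * Q))"
    if "A \<noteq> 0" "B \<noteq> 0" "C \<noteq> 0" for pi' A B C X Y w Z V P Q :: complex
  proof -
    have "- pi' * A * B * C * X / (B * Y) = B * (- (pi' * A * C * X)) / (B * Y)"
      by (simp add: mult_ac)
    also have "\<dots> = - (pi' * A * C * X) / Y"
      using that(2) by (rule mult_divide_mult_cancel_left)
    finally have 1: "- pi' * A * B * C * X / (B * Y) = - (pi' * A * C * X) / Y" .
    have "- pi' * A * B * C * B * Z * V / (A * C * P * Q) = (A * C) * (- (pi' * B ^ 2 * Z * V)) / ((A * C) * (P * Q))"
      by (simp add: mult_ac power2_eq_square)
    also have "\<dots> = - (pi' * B ^ 2 * Z * V) / (P * Q)"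
      using that(1,3) by (intro mult_divide_mult_cancel_left) simp
    finally have 2: "- pi' * A * B * C * B * Z * V / (A * C * P * Q) = - (pi' * B ^ 2 * Z * V) / (P * Q)" .
    show ?thesis
      unfolding 1 2 by (simp add: mult_ac)
  qed
  have "\<theta>' (1/3) (5/3) / \<theta> (1/3) (5/3) =
           1 / 3 * (\<theta>' 1 1 * \<theta> (1/3) (5/3) ^ 3 / (\<theta> 0 1 * \<theta> (2/3) (1/3) ^ 3))
           + zeta_root 3 ^ 2 *
             (\<theta>' 1 1 * \<theta> 0 1 * \<theta> (1/3) (2/3) * \<theta> (2/3) (4/3)
              / (\<theta> 0 0 * \<theta> 1 0 * \<theta> (1/3) (5/3) * \<theta> (2/3) (1/3)))"
    using theta_log_deriv_torsion[OF assms(1)] by (simp only: null derivs)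
  then show ?thesis
    unfolding jacobi by (intro conjI) (assumption, rule cancel[OF nz])
qed

end
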